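(* There exists a sequence $\mathbf C=(C_1,C_2,\dots)$ of positive constants such that the following holds for every finite multiset $M=\{1^{a_1},2^{a_2},\dots\}$ of positive integers with $n=|M|$. Let $\boldsymbol\sigma$ be a uniformly random multiset permutation of $M$ and, for $1\le i\le n$ and $j$ with $a_j>0$, let $X_i^j=\mathbf 1[\boldsymbol\sigma_i=j]$; let $A^M$ be the set of these variables. Let $G^M$ be the weighted complete graph on $A^M$ where the edge between $X_i^j$ and $X_{i'}^{j'}$ has weight $1$ if $i=i'$, weight $1/a_j$ if $i\ne i'$ and $j=j'$, and weight $1/n$ otherwise. Let $\Psi(B)=\prod \frac{a_j}{n}$, the product running over the distinct variables $X_i^j$ in the multiset $B$ of elements of $A^M$. Then $G^M$ is a $(\Psi,\mathbf C)$ weighted dependency graph for the family $A^M$.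
   Context: A multiset permutation of $M$ is a word containing exactly $a_j$ times the letter $j$. For random variables $X_1,\dots,X_r$ with finite moments, the joint cumulant is $\kappa(X_1,\dots,X_r)=\sum_{\pi}\mu(\pi,[r])\prod_{B\in\pi}\mathbb E(\prod_{i\in B}X_i)$, the sum over set partitions $\pi$ of $[r]$ with $\mu$ the Möbius function of the set-partition lattice. For a weighted graph $H$ (edge weights in $(0,1]$; non-edges have weight $0$), $\mathcal M(H)$ is the maximum, over spanning trees of $H$, of the product of the edge weights of the tree ($0$ if $H$ is disconnected). Given a sequence $\mathbf C$ of positive reals and a real function $\Psi$ on multisets of elements of $A$, a weighted graph $G$ on vertex set $A$ is a $(\Psi,\mathbf C)$ weighted dependency graph for a family $\{Y_\alpha,\alpha\in A\}$ of random variables with finite moments if for every multiset $B=\{\alpha_1,\dots,\alpha_r\}$ of elements of $A$, $|\kappa(Y_{\alpha_1},\dots,Y_{\alpha_r})|\le C_r\,\Psi(B)\,\mathcal M(G[B])$, where $G[B]$ is the subgraph induced on the set of distinct elements of $B$. *)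

theory Defs
  imports
    "HOL-Probability.Probability"
    "HOL-Combinatorics.Multiset_Permutations"
begin

section \<open>Joint cumulants\<close>

text \<open>
  Moebius function of a finite poset, given by its order relation \<open>r\<close> (with carrier
  \<open>Field r\<close>): \<open>\<mu>(x,x) = 1\<close> and \<open>\<mu>(x,z) = - (\<Sum>x \<le> y < z. \<mu>(x,y))\<close> for \<open>x < z\<close>. The guard
  (finite partial order) is only there to make the recursion terminate.
\<close>

function poset_mobius :: "'a rel \<Rightarrow> 'a \<Rightarrow> 'a \<Rightarrow> int" where
  "poset_mobius r x z =
     (if x = z then 1
      else if finite r \<and> Partial_order r \<and> (x, z) \<in> r
      then - (\<Sum>y\<in>{y. (x, y) \<in> r \<and> (y, z) \<in> r \<and> y \<noteq> z}. poset_mobius r x y)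
      else 0)"
  by pat_completeness auto
termination
proof (relation "Wellfounded.measure (\<lambda>(r, x, z). card (r\<inverse> `` {z}))", goal_cases)
  case 1
  show ?case by simp
next
  case (2 r x z y)
  then have fin: "finite r" and po: "Partial_order r"
    and y: "(y, z) \<in> r" "y \<noteq> z"
    by auto
  have tr: "trans r" and an: "antisym r" and re: "refl_on (Field r) r"
    using po by (auto simp: partial_order_on_def preorder_on_def)
  have zz: "(z, z) \<in> r"
    using re y by (auto simp: refl_on_def Field_def)
  have "r\<inverse> `` {y} \<subseteq> r\<inverse> `` {z}"
    using tr y by (auto dest: transD)
  moreover have "z \<in> r\<inverse> `` {z}" "z \<notin> r\<inverse> `` {y}"
    using zz an y by (auto dest: antisymD)
  ultimately have "r\<inverse> `` {y} \<subset> r\<inverse> `` {z}"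
    by blast
  moreover have "finite (r\<inverse> `` {z})"
    using fin by (simp add: finite_Image)
  ultimately show ?case
    by (simp add: psubset_card_mono)
qed

declare poset_mobius.simps [simp del]

definition partition_order :: "'a set \<Rightarrow> 'a set set rel" where
  "partition_order S = {(P, Q). refines S P Q}"

text \<open>
  The \<open>i\<close>-th variable of the list is \<open>Xs ! (i - 1)\<close> for \<open>i \<in> {1..r}\<close>; \<open>{{1..r}}\<close> is the
  one-block partition, the top of the partition lattice. Intended for nonempty lists only.
\<close>

definition joint_cumulant :: "'w measure \<Rightarrow> ('w \<Rightarrow> real) list \<Rightarrow> real" where
  "joint_cumulant N Xs =
     (let r = length Xs in
      \<Sum>P | partition_on {1..r} P.
        of_int (poset_mobius (partition_order {1..r}) P {{1..r}}) *
        (\<Prod>B\<in>P. \<integral>\<omega>. (\<Prod>i\<in>B. (Xs ! (i - 1)) \<omega>) \<partial>N))"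


section \<open>Weighted graphs\<close>

record 'v wgraph =
  verts :: "'v set"
  weight :: "'v \<Rightarrow> 'v \<Rightarrow> real"

text \<open>
  Simple undirected graphs with edge weights in \<open>(0, 1]\<close>; weight \<open>0\<close> encodes a non-edge.
  Values of \<open>weight\<close> outside \<open>verts\<close> are irrelevant.
\<close>

definition weighted_graph :: "'v wgraph \<Rightarrow> bool" where
  "weighted_graph G \<longleftrightarrow>
     (\<forall>u\<in>verts G. weight G u u = 0) \<and>
     (\<forall>u\<in>verts G. \<forall>v\<in>verts G.
        weight G u v = weight G v u \<and> 0 \<le> weight G u v \<and> weight G u v \<le> 1)"

definition edges :: "'v wgraph \<Rightarrow> 'v set set" where
  "edges G = {{u, v} | u v. u \<in> verts G \<and> v \<in> verts G \<and> u \<noteq> v \<and> weight G u v > 0}"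

text \<open>Well defined on edges because \<open>weight\<close> is symmetric.\<close>

definition edge_weight :: "'v wgraph \<Rightarrow> 'v set \<Rightarrow> real" where
  "edge_weight G e = (THE x. \<exists>u v. e = {u, v} \<and> x = weight G u v)"

definition induced :: "'v wgraph \<Rightarrow> 'v set \<Rightarrow> 'v wgraph" where
  "induced G S = G\<lparr>verts := verts G \<inter> S\<rparr>"

definition connected_by :: "'v set \<Rightarrow> 'v set set \<Rightarrow> bool" where
  "connected_by V T \<longleftrightarrow> (\<forall>u\<in>V. \<forall>v\<in>V. (u, v) \<in> {(x, y). {x, y} \<in> T}\<^sup>*)"

definition is_cycle :: "'v set set \<Rightarrow> 'v list \<Rightarrow> bool" where
  "is_cycle T c \<longleftrightarrow> length c \<ge> 3 \<and> distinct c \<and>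
     (\<forall>i<length c. {c ! i, c ! (Suc i mod length c)} \<in> T)"

text \<open>A spanning tree is given by its set of edges.\<close>

definition spanning_tree :: "'v wgraph \<Rightarrow> 'v set set \<Rightarrow> bool" where
  "spanning_tree G T \<longleftrightarrow> T \<subseteq> edges G \<and> connected_by (verts G) T \<and> (\<nexists>c. is_cycle T c)"

text \<open>For finite \<open>G\<close>; the first case is that of a disconnected graph.\<close>

definition max_spanning_tree_weight :: "'v wgraph \<Rightarrow> real" where
  "max_spanning_tree_weight G =
     (if \<not> connected_by (verts G) (edges G) then 0
      else Max {\<Prod>e\<in>T. edge_weight G e | T. spanning_tree G T})"


section \<open>Weighted dependency graphs\<close>

text \<open>
  The multiset \<open>B = {\<alpha>\<^sub>1, \<dots>, \<alpha>\<^sub>r}\<close> is presented by a list \<open>\<alpha>s = [\<alpha>\<^sub>1, \<dots>, \<alpha>\<^sub>r]\<close>, \<open>r \<ge> 1\<close>; both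
  sides of the bound depend only on \<open>mset \<alpha>s\<close>. The constants are indexed from \<open>1\<close>.
\<close>

definition weighted_dependency_graph ::
  "('v multiset \<Rightarrow> real) \<Rightarrow> (nat \<Rightarrow> real) \<Rightarrow> 'w measure \<Rightarrow> 'v set \<Rightarrow> ('v \<Rightarrow> 'w \<Rightarrow> real)
     \<Rightarrow> 'v wgraph \<Rightarrow> bool" where
  "weighted_dependency_graph \<Psi> C N A Y G \<longleftrightarrow>
     prob_space N \<and>
     (\<forall>\<alpha>\<in>A. Y \<alpha> \<in> borel_measurable N \<and> (\<forall>k::nat. integrable N (\<lambda>\<omega>. \<bar>Y \<alpha> \<omega>\<bar> ^ k))) \<and>
     weighted_graph G \<and> verts G = A \<and>
     (\<forall>r\<ge>1. C r > 0) \<and>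
     (\<forall>\<alpha>s. \<alpha>s \<noteq> [] \<and> set \<alpha>s \<subseteq> A \<longrightarrow>
        \<bar>joint_cumulant N (map Y \<alpha>s)\<bar>
          \<le> C (length \<alpha>s) * \<Psi> (mset \<alpha>s) * max_spanning_tree_weight (induced G (set \<alpha>s)))"


section \<open>Random multiset permutations\<close>

text \<open>
  The pair \<open>(i, j)\<close> is the label of the variable \<open>X\<^sub>i\<^sup>j\<close>. The set \<open>A\<^sup>M\<close> and the graph \<open>G\<^sup>M\<close> are
  built on labels, since different labels may carry the same function
  (e.g. if \<open>M\<close> has only one distinct letter).
\<close>

definition perm_space :: "nat multiset \<Rightarrow> nat list measure" where
  "perm_space M = measure_pmf (pmf_of_set (permutations_of_multiset M))"

definition perm_index :: "nat multiset \<Rightarrow> (nat \<times> nat) set" where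
  "perm_index M = {1..size M} \<times> set_mset M"

fun perm_var :: "nat \<times> nat \<Rightarrow> nat list \<Rightarrow> real" where
  "perm_var (i, j) \<sigma> = (if \<sigma> ! (i - 1) = j then 1 else 0)"

fun perm_weight :: "nat multiset \<Rightarrow> nat \<times> nat \<Rightarrow> nat \<times> nat \<Rightarrow> real" where
  "perm_weight M (i, j) (i', j') =
     (if (i, j) = (i', j') then 0
      else if i = i' then 1
      else if j = j' then 1 / real (count M j)
      else 1 / real (size M))"

definition perm_graph :: "nat multiset \<Rightarrow> (nat \<times> nat) wgraph" where
  "perm_graph M = \<lparr>verts = perm_index M, weight = perm_weight M\<rparr>"

definition perm_Psi :: "nat multiset \<Rightarrow> (nat \<times> nat) multiset \<Rightarrow> real" where
  "perm_Psi M B = (\<Prod>(i, j)\<in>set_mset B. real (count M j) / real (size M))"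

end

theory Submission
  imports Defs
begin

text \<open>
  Write \<open>f(T)\<close> for the mean of the product of the variables with index in \<open>T\<close> and \<open>K(T)\<close> for their
  joint cumulant; the bound is proved for all \<open>K(S)\<close> by induction on \<open>card S\<close>.

  If two indices \<open>x, y\<close> of \<open>S\<close> have the same position, then \<open>X\<^sub>x X\<^sub>y\<close> is \<open>X\<^sub>x\<close> or \<open>0\<close>, and the cumulant
  of a family containing a product gives, with \<open>c = 1\<close> or \<open>c = 0\<close> and \<open>R = S - {x, y}\<close>,
  \<open>K(S) = c K(S - {y}) - (\<Sum>A\<subseteq>R. K({x} \<union> A) K({y} \<union> (R - A)))\<close>; each product is controlled by joining
  two trees along a vertex or an edge of weight \<open>1\<close>.

  If all positions are distinct, exchangeability gives
  \<open>(n - card U) f({x} \<union> U) = (a - k(U)) f(U)\<close>, where \<open>a\<close> is the multiplicity of the letter of \<open>x\<close> and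
  \<open>k(U)\<close> counts the indices in \<open>U\<close> with that letter. In terms of cumulants, for \<open>R = S - {x}\<close>,
  \<open>(n - card R) K(S) = (\<Sum>A\<subseteq>R. K({x} \<union> A) card (R - A) K(R - A)) - k(R) K(R)\<close>. Division by \<open>n - card R\<close>
  supplies the factor \<open>1/n\<close> that joins two trees, or, in the last term, the factor
  \<open>(a/n) (1/a)\<close> that joins \<open>x\<close> to an index with the same letter.
\<close>

section \<open>Moebius inversion on the partition lattice\<close>

text \<open>The defining recursion with the term at \<open>z\<close> moved to the other side of the
  equation; the assumptions place \<open>(x, z)\<close> in its main branch.\<close>

lemma poset_mobius_sum_left:
  assumes "finite r" "Partial_order r" "(x, z) \<in> r"
  shows "(\<Sum>y | (x, y) \<in> r \<and> (y, z) \<in> r. poset_mobius r x y) = (if x = z then 1 else 0)"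
proof -
  have po: "trans r" "antisym r" "refl_on (Field r) r"
    using assms(2) by (auto simp: partial_order_on_def preorder_on_def)
  have zz: "(z, z) \<in> r"
    using po(3) assms(3) by (auto simp: refl_on_def Field_def)
  have fin: "finite {y. (x, y) \<in> r \<and> (y, z) \<in> r \<and> y \<noteq> z}"
    by (rule finite_subset[of _ "Field r"]) (use assms(1) in \<open>auto simp: Field_def finite_Domain finite_Range\<close>)
  show ?thesis
  proof (cases "x = z")
    case True
    then have "{y. (x, y) \<in> r \<and> (y, z) \<in> r} = {z}"
      using zz po(2) by (auto dest: antisymD)
    then show ?thesis
      using True by (simp add: poset_mobius.simps[of r z z])
  next
    case False
    have "{y. (x, y) \<in> r \<and> (y, z) \<in> r} = insert z {y. (x, y) \<in> r \<and> (y, z) \<in> r \<and> y \<noteq> z}"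
      using zz assms(3) by auto
    then show ?thesis
      using False assms fin by (simp add: poset_mobius.simps[of r x z])
  qed
qed

text \<open>Evaluates \<open>\<Sum>\<^sub>y\<^sub>\<le>\<^sub>w \<mu>(x,y) \<mu>(w,z)\<close> in both orders of summation.\<close>

lemma poset_mobius_sum_right:
  assumes fin: "finite r" and po: "Partial_order r"
  shows "(x, z) \<in> r \<Longrightarrow> (\<Sum>y | (x, y) \<in> r \<and> (y, z) \<in> r. poset_mobius r y z) = (if x = z then 1 else 0)"
proof (induction "card (r `` {x})" arbitrary: x rule: less_induct)
  case less
  have ax: "trans r" "antisym r" "refl_on (Field r) r"
    using po by (auto simp: partial_order_on_def preorder_on_def)
  have fi: "finite {y. (a, y) \<in> r \<and> P y}" for a P
    by (rule finite_subset[of _ "Field r"]) (use fin in \<open>auto simp: Field_def finite_Domain finite_Range\<close>)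
  have xx: "(x, x) \<in> r" and zz: "(z, z) \<in> r"
    using ax(3) less.prems by (auto simp: refl_on_def Field_def)
  define I where "I = {y. (x, y) \<in> r \<and> (y, z) \<in> r}"
  define D where "D y = (\<Sum>w | (y, w) \<in> r \<and> (w, z) \<in> r. poset_mobius r w z)" for y
  have finI: "finite I"
    unfolding I_def by (rule fi)
  have xI: "x \<in> I" and zI: "z \<in> I"
    using less.prems xx zz by (auto simp: I_def)
  have "(\<Sum>y\<in>I. poset_mobius r x y * D y)
      = (\<Sum>y\<in>I. \<Sum>w | w \<in> I \<and> (y, w) \<in> r. poset_mobius r x y * poset_mobius r w z)"
  proof (rule sum.cong)
    fix y assume y: "y \<in> I"
    have "{w. (y, w) \<in> r \<and> (w, z) \<in> r} = {w \<in> I. (y, w) \<in> r}"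
      using y ax(1) by (auto simp: I_def dest: transD)
    then show "poset_mobius r x y * D y = (\<Sum>w | w \<in> I \<and> (y, w) \<in> r. poset_mobius r x y * poset_mobius r w z)"
      by (simp add: D_def sum_distrib_left)
  qed simp
  also have "\<dots> = (\<Sum>w\<in>I. \<Sum>y | y \<in> I \<and> (y, w) \<in> r. poset_mobius r x y * poset_mobius r w z)"
    by (rule sum.swap_restrict) (use finI in auto)
  also have "\<dots> = (\<Sum>w\<in>I. (if x = w then 1 else 0) * poset_mobius r w z)"
  proof (rule sum.cong)
    fix w assume w: "w \<in> I"
    have "{y \<in> I. (y, w) \<in> r} = {y. (x, y) \<in> r \<and> (y, w) \<in> r}"
      using w ax(1) by (auto simp: I_def dest: transD)
    moreover have "(\<Sum>y | (x, y) \<in> r \<and> (y, w) \<in> r. poset_mobius r x y) = (if x = w then 1 else 0)"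
      by (rule poset_mobius_sum_left) (use fin po w in \<open>auto simp: I_def\<close>)
    ultimately show "(\<Sum>y | y \<in> I \<and> (y, w) \<in> r. poset_mobius r x y * poset_mobius r w z)
        = (if x = w then 1 else 0) * poset_mobius r w z"
      by (simp flip: sum_distrib_right)
  qed simp
  also have "\<dots> = poset_mobius r x z"
    using finI xI by (simp add: if_distrib[of "\<lambda>t. t * _"] cong: if_cong)
  finally have total: "(\<Sum>y\<in>I. poset_mobius r x y * D y) = poset_mobius r x z" .
  \<comment> \<open>The up-set of such a \<open>y\<close> is strictly smaller than that of
    \<open>x\<close>, so \<open>D\<close> is known on the interval except at \<open>x\<close>;
    \<open>total\<close> is then solved for \<open>D x\<close>.\<close>
  have IH: "D y = (if y = z then 1 else 0)" if "y \<in> I" "y \<noteq> x" for y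
    unfolding D_def
  proof (rule less.hyps)
    have "r `` {y} \<subset> r `` {x}"
      using that ax xx by (auto simp: I_def dest: transD antisymD)
    then show "card (r `` {y}) < card (r `` {x})"
      by (rule psubset_card_mono[rotated]) (use fin in \<open>simp add: finite_Image\<close>)
    show "(y, z) \<in> r"
      using that by (simp add: I_def)
  qed
  show ?case
  proof (cases "x = z")
    case True
    then have "I = {z}"
      using ax(2) zz by (auto simp: I_def dest: antisymD)
    then show ?thesis
      using True by (simp add: I_def poset_mobius.simps[of r z z])
  next
    case False
    have "(\<Sum>y\<in>I. poset_mobius r x y * D y) = D x + (\<Sum>y\<in>I - {x}. poset_mobius r x y * (if y = z then 1 else 0))"
      using finI xI IH by (simp add: sum.remove[of I x] poset_mobius.simps[of r x x])
    also have "\<dots> = D x + poset_mobius r x z"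
      using finI zI False by (simp add: if_distrib[of "\<lambda>t. _ * t"] cong: if_cong)
    finally show ?thesis
      using total False by (simp add: D_def)
  qed
qed

section \<open>Cumulants of a set function and their agreement with the Moebius formula\<close>

text \<open>The moment-cumulant formula solved for the one-block partition, so that later arguments
  avoid Moebius functions. At the empty set the value is \<open>f {} - 1\<close>, hence 0 for a
  normalized \<open>f\<close>.\<close>

function cumulant :: "('a set \<Rightarrow> real) \<Rightarrow> 'a set \<Rightarrow> real" where
  "cumulant f S =
     (if finite S then f S - (\<Sum>P | partition_on S P \<and> P \<noteq> {S}. \<Prod>B\<in>P. cumulant f B) else 0)"
  by pat_completeness auto
termination
proof (relation "Wellfounded.measure (\<lambda>(f, S). card S)", goal_cases)
  case (2 f S P B)
  then have P: "partition_on S P" "P \<noteq> {S}" "B \<in> P" "finite S"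
    by auto
  have "B \<noteq> S"
  proof
    assume "B = S"
    have "C = S" if "C \<in> P" for C
    proof (rule ccontr)
      assume "C \<noteq> S"
      moreover have "pairwise disjnt P" "S \<in> P"
        using P(1,3) \<open>B = S\<close> by (simp_all add: partition_on_def)
      ultimately have "disjnt C S"
        using that by (metis pairwiseD)
      moreover have "C \<noteq> {}" "C \<subseteq> S"
        using that P(1) by (auto simp: partition_on_def)
      ultimately show False
        by (simp add: disjnt_def inf.absorb1)
    qed
    then have "P = {S}"
      using P(3) by blast
    then show False
      using P(2) by contradiction
  qed
  moreover have "B \<subseteq> S"
    using P by (auto simp: partition_on_def)
  ultimately show ?case
    using P by (simp add: psubset_card_mono psubsetI)
qed simp

declare cumulant.simps [simp del]

lemma cumulant_cong:
  assumes "\<And>B. B \<subseteq> S \<Longrightarrow> f B = g B"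
  shows "cumulant f S = cumulant g S"
  using assms
proof (induction f S rule: cumulant.induct)
  case (1 f S)
  have "(\<Sum>P | partition_on S P \<and> P \<noteq> {S}. \<Prod>B\<in>P. cumulant f B)
      = (\<Sum>P | partition_on S P \<and> P \<noteq> {S}. \<Prod>B\<in>P. cumulant g B)" if "finite S"
  proof (intro sum.cong prod.cong refl)
    fix P B assume P: "P \<in> {P. partition_on S P \<and> P \<noteq> {S}}" and B: "B \<in> P"
    then have "B \<subseteq> S"
      by (auto simp: partition_on_def)
    then show "cumulant f B = cumulant g B"
      using 1(1)[OF that P B] 1(2) by auto
  qed
  then show ?case
    using 1(2)[of S] by (simp add: cumulant.simps[of f S] cumulant.simps[of g S])
qed

text \<open>Puts the one-block partition back into the recursion. The hypothesis
  \<open>f {} = 1\<close> covers the empty set, whose only partition has an empty product.\<close>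

lemma sum_partitions_cumulant:
  assumes "finite S" "f {} = 1"
  shows "(\<Sum>P | partition_on S P. \<Prod>B\<in>P. cumulant f B) = f S"
proof (cases "S = {}")
  case True
  then show ?thesis
    using assms by (simp add: partition_on_empty)
next
  case False
  have "{P. partition_on S P} = insert {S} {P. partition_on S P \<and> P \<noteq> {S}}"
    using False by (auto intro: partition_on_space)
  moreover have "finite {P. partition_on S P \<and> P \<noteq> {S}}"
    by (rule finite_subset[OF _ finitely_many_partition_on[OF assms(1)]]) auto
  ultimately show ?thesis
    using assms by (simp add: cumulant.simps[of f S])
qed

text \<open>Choosing a partition of every block of \<open>Q\<close> independently amounts to
  choosing a refinement of \<open>Q\<close>. The induction splits off one block \<open>B\<close>: a
  refinement is separated into its blocks inside \<open>B\<close> and its blocks inside the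
  rest.\<close>

lemma prod_sum_partitions:
  fixes g :: "'a set \<Rightarrow> 'b :: comm_semiring_1"
  assumes "finite Q" "disjoint Q" "{} \<notin> Q" "\<And>B. B \<in> Q \<Longrightarrow> finite B"
  shows "(\<Prod>B\<in>Q. \<Sum>P | partition_on B P. \<Prod>C\<in>P. g C) = (\<Sum>P | refines (\<Union>Q) P Q. \<Prod>C\<in>P. g C)"
  using assms
proof (induction Q rule: finite_induct)
  case empty
  have "{P. refines {} P {}} = {{} :: 'a set set}"
    by (auto simp: refines_def partition_on_empty)
  then show ?case by simp
next
  case (insert B Q)
  have dis: "disjoint Q" "B \<inter> \<Union>Q = {}" "B \<noteq> {}" "finite B" "finite (\<Union>Q)" "{} \<notin> Q"
  proof -
    show "disjoint Q"
      using insert.prems(1) by (simp add: pairwise_insert)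
    have "B \<inter> C = {}" if "C \<in> Q" for C
      using insert.prems(1) insert.hyps that by (auto simp: pairwise_insert disjnt_def)
    then show "B \<inter> \<Union>Q = {}" by auto
  qed (use insert.prems insert.hyps in auto)
  have fQ: "finite {P. refines (\<Union>Q) P Q}"
    by (rule finite_subset[OF _ finitely_many_partition_on[OF dis(5)]]) (auto simp: refines_def)
  have "(\<Sum>P | refines (\<Union>(insert B Q)) P (insert B Q). \<Prod>C\<in>P. g C)
      = (\<Sum>(P1, P2)\<in>{P. partition_on B P} \<times> {P. refines (\<Union>Q) P Q}. (\<Prod>C\<in>P1. g C) * (\<Prod>C\<in>P2. g C))"
  proof (rule sum.reindex_bij_witness
      [where j = "\<lambda>P. ({C \<in> P. C \<subseteq> B}, {C \<in> P. C \<subseteq> \<Union>Q})" and i = "\<lambda>(P1, P2). P1 \<union> P2"])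
    fix P assume "P \<in> {P. refines (\<Union>(insert B Q)) P (insert B Q)}"
    then have P: "refines (\<Union>(insert B Q)) P (insert B Q)" by simp
    then have pP: "partition_on (B \<union> \<Union>Q) P" and sub: "\<And>C. C \<in> P \<Longrightarrow> C \<subseteq> B \<or> (\<exists>D\<in>Q. C \<subseteq> D)"
      by (auto simp: refines_def)
    have ne: "\<And>C. C \<in> P \<Longrightarrow> C \<noteq> {}"
      using pP by (auto simp: partition_on_def)
    have un: "{C \<in> P. C \<subseteq> B} \<union> {C \<in> P. C \<subseteq> \<Union>Q} = P"
      using sub by blast
    then show "(case ({C \<in> P. C \<subseteq> B}, {C \<in> P. C \<subseteq> \<Union>Q}) of (P1, P2) \<Rightarrow> P1 \<union> P2) = P"
      by simp
    have p1: "partition_on B {C \<in> P. C \<subseteq> B}"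
      by (rule refines_obtains_subset[OF P]) simp
    have p2: "refines (\<Union>Q) {C \<in> P. C \<subseteq> \<Union>Q} Q"
      unfolding refines_def
    proof (intro conjI ballI)
      show "partition_on (\<Union>Q) {C \<in> P. C \<subseteq> \<Union>Q}"
      proof (rule partition_onI)
        have "\<Union>Q \<subseteq> \<Union>P"
          using pP by (auto simp: partition_on_def)
        then show "\<Union>{C \<in> P. C \<subseteq> \<Union>Q} = \<Union>Q"
          using sub dis(2) by blast
      qed (use pP in \<open>auto simp: partition_on_def pairwise_def\<close>)
      show "partition_on (\<Union>Q) Q"
        using dis by (simp add: partition_on_def)
      fix C assume C: "C \<in> {C \<in> P. C \<subseteq> \<Union>Q}"
      then have "\<not> C \<subseteq> B"
        using dis(2) ne[of C] by auto
      then show "\<exists>Y\<in>Q. C \<subseteq> Y"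
        using C sub by blast
    qed
    show "({C \<in> P. C \<subseteq> B}, {C \<in> P. C \<subseteq> \<Union>Q}) \<in> {P. partition_on B P} \<times> {P. refines (\<Union>Q) P Q}"
      using p1 p2 by simp
    have "finite P"
      using pP dis by (intro finite_elements[of "B \<union> \<Union>Q"]) auto
    moreover have "{C \<in> P. C \<subseteq> B} \<inter> {C \<in> P. C \<subseteq> \<Union>Q} = {}"
      using dis(2) ne by blast
    ultimately have "(\<Prod>C\<in>{C \<in> P. C \<subseteq> B} \<union> {C \<in> P. C \<subseteq> \<Union>Q}. g C)
        = (\<Prod>C | C \<in> P \<and> C \<subseteq> B. g C) * (\<Prod>C | C \<in> P \<and> C \<subseteq> \<Union>Q. g C)"
      by (intro prod.union_disjoint) auto
    then show "(case ({C \<in> P. C \<subseteq> B}, {C \<in> P. C \<subseteq> \<Union>Q}) of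
        (P1, P2) \<Rightarrow> (\<Prod>C\<in>P1. g C) * (\<Prod>C\<in>P2. g C)) = (\<Prod>C\<in>P. g C)"
      by (simp only: un split)
  next
    fix PP assume "PP \<in> {P. partition_on B P} \<times> {P. refines (\<Union>Q) P Q}"
    then obtain P1 P2 where PP: "PP = (P1, P2)" and p1: "partition_on B P1" and p2: "refines (\<Union>Q) P2 Q"
      by auto
    have u: "\<Union>P1 = B" "\<Union>P2 = \<Union>Q" "{} \<notin> P1" "{} \<notin> P2" "disjoint P1" "disjoint P2"
      using p1 p2 by (auto simp: refines_def partition_on_def)
    have "{C \<in> P1 \<union> P2. C \<subseteq> B} = P1" 
    proof -
      have "C \<notin> P2" if "C \<subseteq> B" for C
        using that u dis(2) by (metis Int_Un_eq(1) Int_absorb1 Sup_upper inf.absorb_iff2 inf_assoc inf_bot_right subset_empty)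
      then show ?thesis using u by auto
    qed
    moreover have "{C \<in> P1 \<union> P2. C \<subseteq> \<Union>Q} = P2"
    proof -
      have "C \<notin> P1" if "C \<subseteq> \<Union>Q" for C
        using that u dis(2) by (metis Sup_upper inf.bounded_iff subset_empty)
      then show ?thesis using u by auto
    qed
    ultimately show "({C \<in> (case PP of (P1, P2) \<Rightarrow> P1 \<union> P2). C \<subseteq> B},
        {C \<in> (case PP of (P1, P2) \<Rightarrow> P1 \<union> P2). C \<subseteq> \<Union>Q}) = PP"
      by (simp add: PP)
    have "partition_on (B \<union> \<Union>Q) (P1 \<union> P2)"
    proof (rule partition_onI)
      fix p q assume pq: "p \<in> P1 \<union> P2" "q \<in> P1 \<union> P2" "p \<noteq> q"
      show "disjnt p q"
      proof (cases "p \<in> P1 \<longleftrightarrow> q \<in> P1")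
        case True
        then show ?thesis using pq u by (auto simp: pairwise_def)
      next
        case False
        then have "p \<subseteq> B \<and> q \<subseteq> \<Union>Q \<or> q \<subseteq> B \<and> p \<subseteq> \<Union>Q"
          using pq u by auto
        then show ?thesis using dis(2) by (auto simp: disjnt_def)
      qed
    qed (use u in auto)
    moreover have "partition_on (B \<union> \<Union>Q) (insert B Q)"
      using insert.prems by (simp add: partition_on_def)
    moreover have "\<exists>Y\<in>insert B Q. X \<subseteq> Y" if "X \<in> P1 \<union> P2" for X
      using that u p2 by (auto simp: refines_def)
    ultimately show "(case PP of (P1, P2) \<Rightarrow> P1 \<union> P2) \<in> {P. refines (\<Union>(insert B Q)) P (insert B Q)}"
      by (simp add: PP refines_def)
  qed
  then show ?case
    using insert.IH insert.hyps insert.prems dis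
    by (simp add: sum.cartesian_product[symmetric] sum_product)
qed

lemma finite_partition_order: "finite S \<Longrightarrow> finite (partition_order S)"
  by (rule finite_subset[of _ "{P. partition_on S P} \<times> {P. partition_on S P}"])
     (auto simp: partition_order_def refines_def finitely_many_partition_on)

lemma Partial_order_partition_order: "Partial_order (partition_order S)"
proof -
  have "Field (partition_order S) = {P. partition_on S P}"
    by (auto simp: partition_order_def Field_def refines_def)
  then show ?thesis
    unfolding partial_order_on_def preorder_on_def
  proof (intro conjI refl_onI transI antisymI)
    show "partition_order S \<subseteq> Field (partition_order S) \<times> Field (partition_order S)"
      by (auto simp: Field_def)
  qed (auto simp: partition_order_def refines_refl dest: refines_trans refines_asym)
qed

text \<open>Each product of moments over a partition \<open>P\<close> expands into the products
  \<open>k Q\<close> over the refinements \<open>Q\<close> of \<open>P\<close>. After exchanging the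
  sums, Moebius inversion removes every \<open>Q\<close> except the one-block partition.\<close>

lemma joint_cumulant_eq_cumulant:
  fixes N :: "'w measure" and Xs :: "('w \<Rightarrow> real) list"
  defines "f \<equiv> \<lambda>B. \<integral>\<omega>. (\<Prod>i\<in>B. (Xs ! (i - 1)) \<omega>) \<partial>N"
  assumes "prob_space N" "Xs \<noteq> []"
  shows "joint_cumulant N Xs = cumulant f {1..length Xs}"
proof -
  define S where "S = {1..length Xs}"
  define r where "r = partition_order S"
  define k where "k P = (\<Prod>B\<in>P. cumulant f B)" for P
  have S: "finite S" "S \<noteq> {}"
    using assms(3) by (auto simp: S_def Suc_le_eq)
  have fp: "finite {P. partition_on S P}"
    using S by (intro finitely_many_partition_on)
  have f1: "f {} = 1"
    using assms(2) by (simp add: f_def prob_space.prob_space)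
  have top: "(P, {S}) \<in> r" if "partition_on S P" for P
    using that S by (auto simp: r_def partition_order_def refines_def partition_on_space partition_on_def)
  have prod_f: "(\<Prod>B\<in>P. f B) = (\<Sum>Q | partition_on S Q \<and> (Q, P) \<in> r. k Q)" if P: "partition_on S P" for P
  proof -
    have fin: "finite P" "\<And>B. B \<in> P \<Longrightarrow> finite B"
      using P S finite_elements[OF S(1) P] by (auto simp: partition_on_def intro: finite_subset[of _ S])
    have "(\<Prod>B\<in>P. f B) = (\<Prod>B\<in>P. \<Sum>Q | partition_on B Q. \<Prod>C\<in>Q. cumulant f C)"
      using fin f1 by (simp add: sum_partitions_cumulant)
    also have "\<dots> = (\<Sum>Q | refines (\<Union>P) Q P. \<Prod>C\<in>Q. cumulant f C)"
      by (rule prod_sum_partitions) (use P fin in \<open>auto simp: partition_on_def\<close>)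
    also have "{Q. refines (\<Union>P) Q P} = {Q. partition_on S Q \<and> (Q, P) \<in> r}"
      using P by (auto simp: r_def partition_order_def refines_def partition_on_def)
    finally show ?thesis
      by (simp add: k_def)
  qed
  have "joint_cumulant N Xs = (\<Sum>P | partition_on S P. of_int (poset_mobius r P {S}) * (\<Prod>B\<in>P. f B))"
    by (simp add: joint_cumulant_def Let_def f_def r_def S_def)
  also have "\<dots> = (\<Sum>P | partition_on S P. \<Sum>Q | Q \<in> {Q. partition_on S Q} \<and> (Q, P) \<in> r.
      of_int (poset_mobius r P {S}) * k Q)"
    by (rule sum.cong) (simp_all add: prod_f sum_distrib_left)
  also have "\<dots> = (\<Sum>Q | partition_on S Q. \<Sum>P | P \<in> {P. partition_on S P} \<and> (Q, P) \<in> r.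
      of_int (poset_mobius r P {S}) * k Q)"
    by (rule sum.swap_restrict) (use fp in auto)
  also have "\<dots> = (\<Sum>Q | partition_on S Q. (if Q = {S} then 1 else 0) * k Q)"
  proof (rule sum.cong)
    fix Q assume "Q \<in> {Q. partition_on S Q}"
    then have Q: "partition_on S Q" by simp
    have eq: "{P. P \<in> {P. partition_on S P} \<and> (Q, P) \<in> r} = {P. (Q, P) \<in> r \<and> (P, {S}) \<in> r}"
      using top by (auto simp: r_def partition_order_def refines_def)
    have "(\<Sum>P | (Q, P) \<in> r \<and> (P, {S}) \<in> r. poset_mobius r P {S}) = (if Q = {S} then 1 else 0)"
      by (rule poset_mobius_sum_right)
         (use S top[OF Q] in \<open>auto simp: r_def finite_partition_order Partial_order_partition_order\<close>)
    then have "(\<Sum>P | (Q, P) \<in> r \<and> (P, {S}) \<in> r. real_of_int (poset_mobius r P {S})) = (if Q = {S} then 1 else 0)"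
      by (simp flip: of_int_sum)
    then show "(\<Sum>P | P \<in> {P. partition_on S P} \<and> (Q, P) \<in> r. of_int (poset_mobius r P {S}) * k Q)
        = (if Q = {S} then 1 else 0) * k Q"
      unfolding eq sum_distrib_right[symmetric] by simp
  qed simp
  also have "\<dots> = k {S}"
    using fp S by (simp add: if_distrib[of "\<lambda>t. t * _"] partition_on_space cong: if_cong)
  finally show ?thesis
    by (simp add: k_def S_def)
qed

section \<open>Convolution of set functions and recursions for cumulants\<close>

text \<open>Multiplication of polynomials in commuting variables of square zero, a set function
  being the family of coefficients. The unit is the indicator of the empty set.\<close>

definition subset_conv :: "('a set \<Rightarrow> real) \<Rightarrow> ('a set \<Rightarrow> real) \<Rightarrow> 'a set \<Rightarrow> real" where
  "subset_conv g h S = (\<Sum>T\<in>Pow S. g T * h (S - T))"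

lemma subset_conv_cong:
  assumes "\<And>T. T \<subseteq> S \<Longrightarrow> g T = g' T" "\<And>T. T \<subseteq> S \<Longrightarrow> h T = h' T"
  shows "subset_conv g h S = subset_conv g' h' S"
  unfolding subset_conv_def by (rule sum.cong) (auto simp: assms)

text \<open>Both sides sum over the ordered decompositions of \<open>S\<close> into three disjoint
  parts, some of them possibly empty.\<close>

lemma subset_conv_assoc:
  assumes "finite S"
  shows "subset_conv (subset_conv f g) h S = subset_conv f (subset_conv g h) S"
proof -
  have fin: "finite T" if "T \<subseteq> S" for T
    using that assms finite_subset by blast
  have "subset_conv (subset_conv f g) h S = (\<Sum>(T, U)\<in>(SIGMA T:Pow S. Pow T). f U * g (T - U) * h (S - T))"
    unfolding subset_conv_def sum_distrib_right
    by (rule sum.Sigma) (use assms fin in auto)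
  also have "\<dots> = (\<Sum>(U, V)\<in>(SIGMA U:Pow S. Pow (S - U)). f U * (g V * h (S - U - V)))"
    by (rule sum.reindex_bij_witness[where i = "\<lambda>(U, V). (U \<union> V, U)" and j = "\<lambda>(T, U). (U, T - U)"])
       (auto simp: Un_absorb1 Diff_Un algebra_simps intro!: arg_cong2[where f = "(*)"] arg_cong[where f = h]
         arg_cong[where f = g])
  also have "\<dots> = subset_conv f (subset_conv g h) S"
    unfolding subset_conv_def sum_distrib_left
    by (rule sum.Sigma[symmetric]) (use assms in auto)
  finally show ?thesis .
qed

lemma subset_conv_add_left: "subset_conv (\<lambda>A. g A + g' A) h S = subset_conv g h S + subset_conv g' h S"
  by (simp add: subset_conv_def sum.distrib algebra_simps)

lemma subset_conv_diff_left: "subset_conv (\<lambda>A. g A - g' A) h S = subset_conv g h S - subset_conv g' h S"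
  by (simp add: subset_conv_def sum_subtractf algebra_simps)

lemma subset_conv_scale_left: "subset_conv (\<lambda>A. c * g A) h S = c * subset_conv g h S"
  by (simp add: subset_conv_def sum_distrib_left algebra_simps)

lemma subset_conv_unit_left:
  assumes "finite S"
  shows "subset_conv (\<lambda>A. if A = {} then c else 0) h S = c * h S"
proof -
  have "subset_conv (\<lambda>A. if A = {} then c else 0) h S = (\<Sum>T\<in>Pow S. if T = {} then c * h S else 0)"
    unfolding subset_conv_def by (rule sum.cong) auto
  then show ?thesis
    using assms by simp
qed

text \<open>A function with \<open>f {} = 1\<close> is invertible for the convolution. By induction
  the terms at proper subsets vanish, which leaves \<open>g U * f {}\<close>. Everything is
  restricted to subsets of \<open>R\<close> because the identities for moments are assumed only
  there.\<close>

lemma subset_conv_cancel: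
  assumes "finite R" "f {} = 1" and conv0: "\<And>U. U \<subseteq> R \<Longrightarrow> subset_conv g f U = 0"
  shows "U \<subseteq> R \<Longrightarrow> g U = 0"
proof (induction "card U" arbitrary: U rule: less_induct)
  case less
  have fin: "finite U"
    using less.prems assms(1) finite_subset by blast
  have "g T * f (U - T) = 0" if "T \<in> Pow U - {U}" for T
    using less.hyps[of T] that less.prems fin by (auto simp: psubset_card_mono psubsetI)
  then have "subset_conv g f U = g U * f {}"
    unfolding subset_conv_def by (subst sum.remove[of _ U]) (use fin in \<open>simp_all add: sum.neutral\<close>)
  then show ?case
    using conv0[OF less.prems] assms(2) by simp
qed

lemma abs_subset_conv_le:
  assumes "finite R" "\<And>A. A \<subseteq> R \<Longrightarrow> \<bar>g A * h (R - A)\<bar> \<le> b"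
  shows "\<bar>subset_conv g h R\<bar> \<le> 2 ^ card R * b"
proof -
  have "\<bar>subset_conv g h R\<bar> \<le> (\<Sum>A\<in>Pow R. \<bar>g A * h (R - A)\<bar>)"
    unfolding subset_conv_def by (rule sum_abs)
  also have "\<dots> \<le> card (Pow R) * b"
    by (rule sum_bounded_above) (use assms in auto)
  finally show ?thesis
    using assms(1) by (simp add: card_Pow)
qed

section \<open>Expansion of moments along a block, and the two recursions for cumulants\<close>

text \<open>Groups the partitions of \<open>S\<close> by the block \<open>T\<close> containing
  \<open>x\<close>. The other blocks form an arbitrary partition of \<open>S - T\<close>, and these
  sum to the moment \<open>f (S - T)\<close>.\<close>

lemma moment_eq_sum_cumulant:
  assumes S: "finite S" "x \<in> S" and f1: "f {} = 1"
  shows "f S = (\<Sum>T | T \<subseteq> S \<and> x \<in> T. cumulant f T * f (S - T))"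
proof -
  have fin: "finite T" if "T \<subseteq> S" for T
    using that S finite_subset by blast
  define blk where "blk P = (THE B. B \<in> P \<and> x \<in> B)" for P :: "'a set set"
  have blk_eq: "blk P = B" if "pairwise disjnt P" "B \<in> P" "x \<in> B" for P B
    unfolding blk_def
    by (rule the_equality) (use that in \<open>auto simp: pairwise_def disjnt_iff\<close>)
  have blk: "blk P \<in> P" "x \<in> blk P" if P: "partition_on S P" for P
  proof -
    obtain B where "B \<in> P" "x \<in> B"
      using P S(2) unfolding partition_on_def by blast
    then show "blk P \<in> P" "x \<in> blk P"
      using blk_eq[of P B] that by (auto simp: partition_on_def)
  qed
  have "f S = (\<Sum>P | partition_on S P. \<Prod>B\<in>P. cumulant f B)"
    using S f1 by (simp add: sum_partitions_cumulant)
  also have "\<dots> = (\<Sum>(T, P)\<in>(SIGMA T:{T. T \<subseteq> S \<and> x \<in> T}. {P. partition_on (S - T) P}).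
      cumulant f T * (\<Prod>B\<in>P. cumulant f B))"
  proof (rule sum.reindex_bij_witness
      [where i = "\<lambda>(T, P). insert T P" and j = "\<lambda>P. (blk P, P - {blk P})"])
    fix P assume "P \<in> {P. partition_on S P}"
    then have P: "partition_on S P" by simp
    have ins: "insert (blk P) (P - {blk P}) = P"
      using blk[OF P] by auto
    then show "(case (blk P, P - {blk P}) of (T, P) \<Rightarrow> insert T P) = P"
      by simp
    have "disjnt (blk P) (\<Union>(P - {blk P}))"
      using P blk[OF P] by (auto simp: partition_on_def pairwise_def disjnt_iff)
    then have "partition_on (S - blk P) (P - {blk P}) \<and> blk P \<subseteq> S"
      using P ins partition_on_insert by metis
    then show "(blk P, P - {blk P}) \<in> (SIGMA T:{T. T \<subseteq> S \<and> x \<in> T}. {P. partition_on (S - T) P})"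
      using blk[OF P] by simp
    show "(case (blk P, P - {blk P}) of (T, P) \<Rightarrow> cumulant f T * (\<Prod>B\<in>P. cumulant f B)) = (\<Prod>B\<in>P. cumulant f B)"
      using prod.remove[OF finite_elements[OF S(1) P] blk(1)[OF P], of "cumulant f"] by simp
  next
    fix TP assume "TP \<in> (SIGMA T:{T. T \<subseteq> S \<and> x \<in> T}. {P. partition_on (S - T) P})"
    then obtain T P where TP: "TP = (T, P)" "T \<subseteq> S" "x \<in> T" "partition_on (S - T) P"
      by auto
    have "disjnt T (\<Union>P)"
      using TP by (auto simp: partition_on_def disjnt_iff)
    then have part: "partition_on S (insert T P)"
      using TP by (subst partition_on_insert) auto
    have T: "T \<notin> P"
      using TP by (auto simp: partition_on_def)
    have "blk (insert T P) = T"
      by (rule blk_eq) (use part TP in \<open>auto simp: partition_on_def\<close>)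
    then show "(blk (case TP of (T, P) \<Rightarrow> insert T P), (case TP of (T, P) \<Rightarrow> insert T P) -
        {blk (case TP of (T, P) \<Rightarrow> insert T P)}) = TP"
      using T by (simp add: TP)
    show "(case TP of (T, P) \<Rightarrow> insert T P) \<in> {P. partition_on S P}"
      using part by (simp add: TP)
  qed
  also have "\<dots> = (\<Sum>T | T \<subseteq> S \<and> x \<in> T. \<Sum>P | partition_on (S - T) P. cumulant f T * (\<Prod>B\<in>P. cumulant f B))"
    by (rule sum.Sigma[symmetric]) (use S in \<open>auto intro: finitely_many_partition_on\<close>)
  also have "\<dots> = (\<Sum>T | T \<subseteq> S \<and> x \<in> T. cumulant f T * f (S - T))"
    using S f1 by (simp add: sum_partitions_cumulant flip: sum_distrib_left)
  finally show ?thesis .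
qed

text \<open>The convolution form of the expansion by the block of \<open>x\<close>. It is the rule
  for differentiating an exponential: the derivative of \<open>f\<close> in direction
  \<open>x\<close> is that of the cumulants times \<open>f\<close>.\<close>

lemma moment_insert:
  assumes "finite U" "x \<notin> U" "f {} = 1"
  shows "f (insert x U) = subset_conv (\<lambda>A. cumulant f (insert x A)) f U"
proof -
  have "f (insert x U) = (\<Sum>T | T \<subseteq> insert x U \<and> x \<in> T. cumulant f T * f (insert x U - T))"
    using assms by (intro moment_eq_sum_cumulant) auto
  also have "\<dots> = subset_conv (\<lambda>A. cumulant f (insert x A)) f U"
    unfolding subset_conv_def
    by (rule sum.reindex_bij_witness[where i = "insert x" and j = "\<lambda>T. T - {x}"])
       (use assms in \<open>auto simp: insert_absorb intro!: arg_cong[where f = f]\<close>)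
  finally show ?thesis .
qed

lemma cumulant_singleton:
  assumes "f {} = 1"
  shows "cumulant f {x} = f {x}"
  using moment_insert[of "{}" x f] assms by (simp add: subset_conv_def)

text \<open>Adds the expansions over all \<open>x\<close> in \<open>U\<close> with weights
  \<open>m x\<close>; a block \<open>T\<close> then occurs once for each of its elements, with total
  weight \<open>sum m T\<close>.\<close>

lemma sum_mult_moment:
  assumes "finite U" "f {} = 1"
  shows "sum m U * f U = subset_conv (\<lambda>A. sum m A * cumulant f A) f U"
proof -
  have "sum m U * f U = (\<Sum>x\<in>U. \<Sum>T | T \<in> Pow U \<and> x \<in> T. m x * (cumulant f T * f (U - T)))"
    unfolding sum_distrib_right
    by (rule sum.cong) (use assms in \<open>simp_all add: moment_eq_sum_cumulant[of U _ f] flip: sum_distrib_left\<close>)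
  also have "\<dots> = (\<Sum>T\<in>Pow U. \<Sum>x | x \<in> U \<and> x \<in> T. m x * (cumulant f T * f (U - T)))"
    by (rule sum.swap_restrict) (use assms in auto)
  also have "\<dots> = subset_conv (\<lambda>A. sum m A * cumulant f A) f U"
    unfolding subset_conv_def
  proof (rule sum.cong)
    fix T assume "T \<in> Pow U"
    then have "{x. x \<in> U \<and> x \<in> T} = T" by auto
    then show "(\<Sum>x | x \<in> U \<and> x \<in> T. m x * (cumulant f T * f (U - T))) = sum m T * cumulant f T * f (U - T)"
      by (simp add: sum_distrib_right mult.assoc)
  qed simp
  finally show ?thesis .
qed

text \<open>Expands the moment of \<open>insert x (insert y U)\<close> by the block of
  \<open>x\<close>. If \<open>y\<close> lies in it, \<open>Kxy\<close> appears; otherwise the block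
  of \<open>y\<close> is split off as well, giving the convolution of \<open>Kx\<close> and
  \<open>Ky\<close>. Comparison with the merged moment and cancellation of \<open>f\<close> yield
  the formula.\<close>

lemma cumulant_merge:
  assumes "finite R" "x \<notin> R" "y \<notin> R" "x \<noteq> y" and f1: "f {} = 1"
    and merge: "\<And>U. U \<subseteq> R \<Longrightarrow> f (insert x (insert y U)) = c * f (insert x U)"
  shows "cumulant f (insert x (insert y R)) =
    c * cumulant f (insert x R) - subset_conv (\<lambda>A. cumulant f (insert x A)) (\<lambda>A. cumulant f (insert y A)) R"
proof -
  define Kx where "Kx A = cumulant f (insert x A)" for A
  define Ky where "Ky A = cumulant f (insert y A)" for A
  define Kxy where "Kxy A = cumulant f (insert x (insert y A))" for A
  have "Kxy U + subset_conv Kx Ky U - c * Kx U = 0" if "U \<subseteq> R" for U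
  proof (rule subset_conv_cancel[where f = f, OF assms(1) f1 _ that])
    fix U assume U: "U \<subseteq> R"
    then have fin: "finite U" and xy: "x \<notin> U" "y \<notin> U"
      using assms finite_subset by auto
    have moment: "f (insert x U) = subset_conv Kx f U"
      using moment_insert[where f = f, OF fin xy(1) f1] by (simp add: Kx_def[abs_def])
    have "f (insert x (insert y U)) = subset_conv Kx f (insert y U)"
      using moment_insert[of "insert y U" x f] fin xy assms(4) f1 by (simp add: Kx_def[abs_def])
    also have "\<dots> = (\<Sum>T\<in>Pow U. Kx T * f (insert y U - T)) + (\<Sum>T\<in>insert y ` Pow U. Kx T * f (insert y U - T))"
      unfolding subset_conv_def Pow_insert by (rule sum.union_disjoint) (use fin xy in auto)
    also have "(\<Sum>T\<in>insert y ` Pow U. Kx T * f (insert y U - T)) = subset_conv Kxy f U"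
      unfolding subset_conv_def
      by (subst sum.reindex)
         (use xy in \<open>auto simp: Kx_def Kxy_def inj_on_def insert_commute intro!: sum.cong arg_cong[where f = f]\<close>)
    also have "(\<Sum>T\<in>Pow U. Kx T * f (insert y U - T)) = subset_conv Kx (\<lambda>V. f (insert y V)) U"
      unfolding subset_conv_def using xy
      by (intro sum.cong) (auto simp: insert_Diff_if)
    also have "\<dots> = subset_conv Kx (subset_conv Ky f) U"
    proof (rule subset_conv_cong)
      fix T assume "T \<subseteq> U"
      then show "f (insert y T) = subset_conv Ky f T"
        using moment_insert[of T y f] fin xy f1 finite_subset by (auto simp: Ky_def[abs_def])
    qed simp
    also have "\<dots> = subset_conv (subset_conv Kx Ky) f U"
      by (rule subset_conv_assoc[OF fin, symmetric])
    finally have "subset_conv (subset_conv Kx Ky) f U + subset_conv Kxy f U - c * subset_conv Kx f U = 0"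
      using merge[OF U] moment by simp
    then show "subset_conv (\<lambda>U. Kxy U + subset_conv Kx Ky U - c * Kx U) f U = 0"
      by (simp add: subset_conv_diff_left subset_conv_add_left subset_conv_scale_left)
  qed
  from this[of R] show ?thesis
    by (simp add: Kx_def[abs_def] Ky_def[abs_def] Kxy_def algebra_simps)
qed

text \<open>
  On set functions, multiplication by an additive weight such as \<open>card\<close> is a derivation for the
  convolution, of which moments are the exponential of cumulants. This turns the linear recursion
  satisfied by the moments of sampling without replacement into a quadratic one for the cumulants.
\<close>

lemma cumulant_sampling_recursion:
  fixes m :: "'a \<Rightarrow> real" and n a :: real
  assumes R: "finite R" "x \<notin> R" "R \<noteq> {}" and f1: "f {} = 1"
    and rec: "\<And>U. U \<subseteq> R \<Longrightarrow> (n - card U) * f (insert x U) = (a - sum m U) * f U"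
  shows "(n - card R) * cumulant f (insert x R) =
    subset_conv (\<lambda>A. cumulant f (insert x A)) (\<lambda>A. card A * cumulant f A) R - sum m R * cumulant f R"
proof -
  define H where "H A = cumulant f (insert x A)" for A
  define Kc where "Kc A = card A * cumulant f A" for A
  define Km where "Km A = sum m A * cumulant f A" for A
  \<comment> \<open>The difference of the two sides of the claim, corrected by \<open>a\<close>
    times the convolution unit. The correction vanishes at \<open>R\<close> because \<open>R\<close>
    is nonempty.\<close>
  define g where "g A = n * H A - card A * H A - subset_conv H Kc A - (if A = {} then a else 0) + Km A" for A
  have "g U = 0" if "U \<subseteq> R" for U
  proof (rule subset_conv_cancel[where f = f, OF R(1) f1 _ that])
    fix U assume U: "U \<subseteq> R"
    then have fin: "finite U" and xU: "x \<notin> U"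
      using R finite_subset by auto
    have fx: "f (insert x U) = subset_conv H f U"
      using moment_insert[where f = f, OF fin xU f1] by (simp add: H_def[abs_def])
    have Km: "sum m U * f U = subset_conv Km f U"
      using sum_mult_moment[where f = f, OF fin f1] by (simp add: Km_def[abs_def])
    \<comment> \<open>The Leibniz rule: \<open>card U\<close> is the sum of \<open>card T\<close>
      and \<open>card (U - T)\<close> in every term.\<close>
    have "card U * subset_conv H f U = subset_conv (\<lambda>A. card A * H A) f U + subset_conv H (\<lambda>A. card A * f A) U"
    proof -
      have "real (card U) = real (card T) + real (card (U - T))" if "T \<subseteq> U" for T
        using card_mono[OF fin that] card_Diff_subset[OF finite_subset[OF that fin] that] by simp
      then show ?thesis
        unfolding subset_conv_def sum_distrib_left sum.distrib[symmetric]
        by (intro sum.cong) (auto simp: algebra_simps)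
    qed
    also have "subset_conv H (\<lambda>A. card A * f A) U = subset_conv H (subset_conv Kc f) U"
    proof (rule subset_conv_cong)
      fix T assume "T \<subseteq> U"
      then show "card T * f T = subset_conv Kc f T"
        using sum_mult_moment[of T f "\<lambda>_. 1"] fin f1 finite_subset by (auto simp: Kc_def[abs_def])
    qed simp
    also have "\<dots> = subset_conv (subset_conv H Kc) f U"
      by (rule subset_conv_assoc[OF fin, symmetric])
    finally have card: "card U * subset_conv H f U
        = subset_conv (\<lambda>A. card A * H A) f U + subset_conv (subset_conv H Kc) f U" .
    have "subset_conv g f U = n * subset_conv H f U - subset_conv (\<lambda>A. card A * H A) f U
        - subset_conv (subset_conv H Kc) f U - a * f U + subset_conv Km f U"
      unfolding g_def
      by (simp add: subset_conv_diff_left subset_conv_add_left subset_conv_scale_left subset_conv_unit_left[OF fin])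
    also have "\<dots> = 0"
      using rec[OF U] card unfolding fx left_diff_distrib Km by linarith
    finally show "subset_conv g f U = 0" .
  qed
  from this[of R] show ?thesis
    using R(3) by (simp add: g_def H_def[abs_def] Kc_def[abs_def] Km_def algebra_simps)
qed

section \<open>Maximum spanning trees\<close>

lemma edge_weight_doubleton:
  assumes "weighted_graph G" "u \<in> verts G" "v \<in> verts G"
  shows "edge_weight G {u, v} = weight G u v"
  unfolding edge_weight_def
proof (rule the_equality)
  fix x assume "\<exists>a b. {u, v} = {a, b} \<and> x = weight G a b"
  then show "x = weight G u v"
    using assms by (auto simp: weighted_graph_def doubleton_eq_iff)
qed auto

lemma edge_weight_bounds:
  assumes "weighted_graph G" "e \<in> edges G"
  shows "0 < edge_weight G e" "edge_weight G e \<le> 1"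
  using assms by (auto simp: edges_def edge_weight_doubleton weighted_graph_def)

lemma verts_induced [simp]: "verts (induced G S) = verts G \<inter> S"
  by (simp add: induced_def)

lemma weight_induced [simp]: "weight (induced G S) = weight G"
  by (simp add: induced_def)

lemma edge_weight_induced [simp]: "edge_weight (induced G S) = edge_weight G"
  by (rule ext) (simp add: edge_weight_def)

lemma weighted_graph_induced: "weighted_graph G \<Longrightarrow> weighted_graph (induced G S)"
  by (auto simp: weighted_graph_def)

lemma edges_induced_mono: "S \<subseteq> T \<Longrightarrow> edges (induced G S) \<subseteq> edges (induced G T)"
  unfolding edges_def by auto

lemma finite_edges:
  assumes "finite (verts G)"
  shows "finite (edges G)"
  by (rule finite_subset[of _ "Pow (verts G)"]) (use assms in \<open>auto simp: edges_def\<close>)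

lemma sym_adjacency_rtrancl: "sym ({(x, y). {x, y} \<in> T}\<^sup>*)"
  by (rule sym_rtrancl) (auto simp: sym_def insert_commute)

lemma connected_by_mono:
  assumes "connected_by V T" "T \<subseteq> T'"
  shows "connected_by V T'"
proof -
  have "{(x, y). {x, y} \<in> T}\<^sup>* \<subseteq> {(x, y). {x, y} \<in> T'}\<^sup>*"
    by (rule rtrancl_mono) (use assms in auto)
  then show ?thesis
    using assms by (auto simp: connected_by_def)
qed

text \<open>The closing edge of the cycle can be replaced by the path through the other edges of the
  cycle.\<close>

lemma connected_by_remove_cycle_edge:
  assumes con: "connected_by V T" and c: "is_cycle T c"
  shows "connected_by V (T - {{c ! (length c - 1), c ! 0}})"
proof -
  define l where "l = length c"
  define e where "e = {c ! (l - 1), c ! 0}"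
  define R where "R = {(x, y). {x, y} \<in> T - {e}}"
  have l: "l \<ge> 3" and dist: "distinct c" and cyc: "\<And>i. i < l \<Longrightarrow> {c ! i, c ! (Suc i mod l)} \<in> T"
    using c by (auto simp: is_cycle_def l_def)
  have path: "(c ! 0, c ! i) \<in> R\<^sup>*" if "i < l" for i
    using that
  proof (induction i)
    case (Suc i)
    have "{c ! i, c ! Suc i} \<in> T"
      using cyc[of i] Suc.prems by simp
    \<comment> \<open>Equality would force \<open>i = 0\<close> and \<open>Suc i = l - 1\<close>,
      hence a cycle of length 2.\<close>
    moreover have "{c ! i, c ! Suc i} \<noteq> e"
    proof
      assume "{c ! i, c ! Suc i} = e"
      moreover have "c ! Suc i \<noteq> c ! 0"
        using Suc.prems dist nth_eq_iff_index_eq[of c "Suc i" 0] unfolding l_def by linarith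
      ultimately have "c ! i = c ! 0" "c ! Suc i = c ! (l - 1)"
        by (auto simp: e_def doubleton_eq_iff)
      then have "i = 0" "Suc i = l - 1"
        using Suc.prems dist nth_eq_iff_index_eq[of c i 0] nth_eq_iff_index_eq[of c "Suc i" "l - 1"]
        unfolding l_def by linarith+
      then show False
        using l by simp
    qed
    ultimately have "(c ! i, c ! Suc i) \<in> R"
      by (simp add: R_def)
    then show ?case
      using Suc by (meson Suc_lessD rtrancl.rtrancl_into_rtrancl)
  qed simp
  have sym: "sym (R\<^sup>*)"
    unfolding R_def by (rule sym_adjacency_rtrancl)
  have ends: "(c ! 0, c ! (l - 1)) \<in> R\<^sup>*" "(c ! (l - 1), c ! 0) \<in> R\<^sup>*"
    using path[of "l - 1"] l symD[OF sym] by auto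
  have "{(x, y). {x, y} \<in> T} \<subseteq> R\<^sup>*"
  proof safe
    fix x y assume xy: "{x, y} \<in> T"
    show "(x, y) \<in> R\<^sup>*"
    proof (cases "{x, y} = e")
      case True
      then show ?thesis
        using ends by (auto simp: e_def doubleton_eq_iff)
    qed (use xy in \<open>auto simp: R_def\<close>)
  qed
  then have "{(x, y). {x, y} \<in> T}\<^sup>* \<subseteq> R\<^sup>*"
    by (metis rtrancl_idemp rtrancl_mono)
  then show ?thesis
    using con unfolding connected_by_def R_def e_def l_def by blast
qed

text \<open>As long as there is a cycle, its closing edge is deleted; connectedness survives and the
  number of edges drops.\<close>

lemma connected_contains_spanning_tree:
  assumes "finite E" "E \<subseteq> edges G" "connected_by (verts G) E"
  shows "\<exists>T\<subseteq>E. spanning_tree G T"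
  using assms
proof (induction "card E" arbitrary: E rule: less_induct)
  case less
  show ?case
  proof (cases "\<exists>c. is_cycle E c")
    case False
    then show ?thesis
      using less.prems by (auto simp: spanning_tree_def)
  next
    case True
    then obtain c where c: "is_cycle E c" by auto
    define e where "e = {c ! (length c - 1), c ! 0}"
    \<comment> \<open>The last index of the cycle wraps around to 0, so this is the closing edge
      \<open>e\<close>.\<close>
    have "{c ! (length c - 1), c ! (Suc (length c - 1) mod length c)} \<in> E"
      using c by (auto simp: is_cycle_def simp del: One_nat_def)
    moreover have "Suc (length c - 1) = length c"
      using c unfolding is_cycle_def by linarith
    ultimately have "e \<in> E"
      by (simp add: e_def del: One_nat_def)
    then have "card (E - {e}) < card E"
      using less.prems(1) by (intro card_Diff1_less)
    moreover have "connected_by (verts G) (E - {e})"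
      unfolding e_def by (rule connected_by_remove_cycle_edge[OF less.prems(3) c])
    ultimately obtain T where "T \<subseteq> E - {e}" "spanning_tree G T"
      using less.hyps[of "E - {e}"] less.prems by auto
    then show ?thesis by auto
  qed
qed

lemma finite_tree_weights:
  assumes "finite (verts G)"
  shows "finite {\<Prod>e\<in>T. edge_weight G e | T. spanning_tree G T}"
proof (rule finite_subset)
  show "{\<Prod>e\<in>T. edge_weight G e | T. spanning_tree G T} \<subseteq> (\<lambda>T. \<Prod>e\<in>T. edge_weight G e) ` Pow (edges G)"
    by (auto simp: spanning_tree_def)
  show "finite ((\<lambda>T. \<Prod>e\<in>T. edge_weight G e) ` Pow (edges G))"
    using finite_edges[OF assms] by simp
qed

text \<open>Deleting edges of weight at most 1 cannot lower the product, so a spanning tree inside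
  \<open>E\<close> weighs at least as much as \<open>E\<close>. Lower bounds for the maximum can
  thus use connected edge sets without any check of acyclicity.\<close>

lemma connected_weight_le_max_spanning_tree:
  assumes G: "weighted_graph G" "finite (verts G)" and E: "E \<subseteq> edges G" "connected_by (verts G) E"
  shows "(\<Prod>e\<in>E. edge_weight G e) \<le> max_spanning_tree_weight G"
proof -
  have fin: "finite E"
    using E finite_edges[OF G(2)] finite_subset by auto
  obtain T where T: "T \<subseteq> E" "spanning_tree G T"
    using connected_contains_spanning_tree[OF fin E] by auto
  have b: "0 \<le> edge_weight G e \<and> edge_weight G e \<le> 1" if "e \<in> E" for e
    using edge_weight_bounds[OF G(1), of e] that E by auto
  have "(\<Prod>e\<in>E. edge_weight G e) = (\<Prod>e\<in>E - T. edge_weight G e) * (\<Prod>e\<in>T. edge_weight G e)"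
    by (rule prod.subset_diff[OF T(1) fin])
  also have "\<dots> \<le> (\<Prod>e\<in>T. edge_weight G e)"
    using T b by (intro mult_left_le_one_le prod_nonneg prod_le_1) auto
  also have "\<dots> \<le> Max {\<Prod>e\<in>T. edge_weight G e | T. spanning_tree G T}"
    by (rule Max_ge[OF finite_tree_weights[OF G(2)]]) (use T in auto)
  finally show ?thesis
    using connected_by_mono[OF E(2,1)] by (simp add: max_spanning_tree_weight_def)
qed

lemma max_spanning_tree_attained:
  assumes "finite (verts G)" "connected_by (verts G) (edges G)"
  obtains T where "spanning_tree G T" "max_spanning_tree_weight G = (\<Prod>e\<in>T. edge_weight G e)"
proof -
  have "{\<Prod>e\<in>T. edge_weight G e | T. spanning_tree G T} \<noteq> {}"
    using connected_contains_spanning_tree[OF finite_edges[OF assms(1)] subset_refl assms(2)] by auto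
  from Max_in[OF finite_tree_weights[OF assms(1)] this] show ?thesis
    using that assms(2) by (auto simp: max_spanning_tree_weight_def)
qed

lemma max_spanning_tree_weight_nonneg:
  assumes "weighted_graph G" "finite (verts G)"
  shows "0 \<le> max_spanning_tree_weight G"
proof (cases "connected_by (verts G) (edges G)")
  case True
  have "0 \<le> (\<Prod>e\<in>edges G. edge_weight G e)"
    using edge_weight_bounds(1)[OF assms(1)] by (meson less_imp_le prod_nonneg)
  also have "\<dots> \<le> max_spanning_tree_weight G"
    by (rule connected_weight_le_max_spanning_tree[OF assms subset_refl True])
  finally show ?thesis .
qed (simp add: max_spanning_tree_weight_def)

section \<open>Joining spanning trees of two vertex sets\<close>

text \<open>The left-hand side counts the factors of the intersection twice, and they are at most
  1.\<close>

lemma prod_mult_le_prod_Un: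
  fixes w :: "'a \<Rightarrow> real"
  assumes "finite S" "finite T" "\<And>e. e \<in> S \<union> T \<Longrightarrow> 0 \<le> w e \<and> w e \<le> 1"
  shows "prod w S * prod w T \<le> prod w (S \<union> T)"
proof -
  have "prod w S * prod w T = prod w (S \<union> T) * prod w (S \<inter> T)"
    using assms by (simp add: prod.union_inter)
  also have "\<dots> \<le> prod w (S \<union> T)"
    using assms by (intro mult_right_le_one_le prod_nonneg prod_le_1) auto
  finally show ?thesis .
qed

text \<open>Two optimal trees and the linking edges \<open>F\<close> form a connected edge set on
  the union, and shared edges only help since weights are at most 1. If one part is disconnected,
  the left-hand side is 0. A general \<open>F\<close> covers both a common vertex (\<open>F\<close>
  empty, \<open>x = y\<close>) and a single linking edge.\<close>

lemma max_spanning_tree_weight_join: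
  assumes G: "weighted_graph G" and UV: "finite U" "finite V" "U \<subseteq> verts G" "V \<subseteq> verts G"
    and F: "finite F" "F \<subseteq> edges (induced G (U \<union> V))"
    and xy: "x \<in> U" "y \<in> V" "(x, y) \<in> {(a, b). {a, b} \<in> F}\<^sup>*"
  shows "max_spanning_tree_weight (induced G U) * (\<Prod>e\<in>F. edge_weight G e) * max_spanning_tree_weight (induced G V)
    \<le> max_spanning_tree_weight (induced G (U \<union> V))"
proof -
  let ?GU = "induced G U" and ?GV = "induced G V" and ?GW = "induced G (U \<union> V)"
  have W: "weighted_graph ?GW" "finite (verts ?GW)"
    using G UV by (auto intro: weighted_graph_induced)
  have vs: "verts ?GU = U" "verts ?GV = V" "verts ?GW = U \<union> V"
    using UV by auto
  show ?thesis
  proof (cases "connected_by (verts ?GU) (edges ?GU) \<and> connected_by (verts ?GV) (edges ?GV)")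
    case False
    then show ?thesis
      using max_spanning_tree_weight_nonneg[OF W] by (auto simp: max_spanning_tree_weight_def)
  next
    case True
    obtain T1 where T1: "spanning_tree ?GU T1" "max_spanning_tree_weight ?GU = (\<Prod>e\<in>T1. edge_weight G e)"
      using max_spanning_tree_attained[of ?GU] True UV by auto
    obtain T2 where T2: "spanning_tree ?GV T2" "max_spanning_tree_weight ?GV = (\<Prod>e\<in>T2. edge_weight G e)"
      using max_spanning_tree_attained[of ?GV] True UV by auto
    have con: "connected_by U T1" "connected_by V T2"
      using T1(1) T2(1) vs by (simp_all add: spanning_tree_def)
    define E where "E = T1 \<union> F \<union> T2"
    have sub: "T1 \<subseteq> edges ?GW" "T2 \<subseteq> edges ?GW"
      using T1(1) T2(1) edges_induced_mono[of U "U \<union> V" G] edges_induced_mono[of V "U \<union> V" G]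
      by (auto simp: spanning_tree_def)
    have fin: "finite T1" "finite T2"
      using sub finite_edges[OF W(2)] by (auto intro: finite_subset)
    have EW: "E \<subseteq> edges ?GW"
      using sub F by (simp add: E_def)
    have b: "0 \<le> edge_weight G e \<and> edge_weight G e \<le> 1" if "e \<in> E" for e
      using edge_weight_bounds[OF W(1), of e] that EW by auto
    define R where "R = {(a, b). {a, b} \<in> E}\<^sup>*"
    have R: "{(a, b). {a, b} \<in> T}\<^sup>* \<subseteq> R" if "T \<subseteq> E" for T
      unfolding R_def by (rule rtrancl_mono) (use that in auto)
    have symR: "sym R"
      unfolding R_def by (rule sym_adjacency_rtrancl)
    have transR: "trans R"
      unfolding R_def by (rule trans_rtrancl)
    have "(x, z) \<in> R" if "z \<in> U \<union> V" for z
    proof (cases "z \<in> U")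
      case True
      then have "(x, z) \<in> {(a, b). {a, b} \<in> T1}\<^sup>*"
        using con(1) xy by (simp add: connected_by_def)
      then show ?thesis
        using R[of T1] by (auto simp: E_def)
    next
      case False
      then have "(y, z) \<in> {(a, b). {a, b} \<in> T2}\<^sup>*"
        using con(2) xy that by (simp add: connected_by_def)
      then have "(y, z) \<in> R"
        using R[of T2] by (auto simp: E_def)
      moreover have "(x, y) \<in> R"
        using R[of F] xy by (auto simp: E_def)
      ultimately show ?thesis
        using transR by (meson transD)
    qed
    then have "connected_by (verts ?GW) E"
      unfolding connected_by_def vs R_def[symmetric] using symR transR by (meson symD transD)
    from connected_weight_le_max_spanning_tree[OF W EW this]
    have "(\<Prod>e\<in>E. edge_weight G e) \<le> max_spanning_tree_weight ?GW"
      by simp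
    moreover have "(\<Prod>e\<in>T1. edge_weight G e) * (\<Prod>e\<in>F. edge_weight G e) * (\<Prod>e\<in>T2. edge_weight G e)
        \<le> (\<Prod>e\<in>T1 \<union> F. edge_weight G e) * (\<Prod>e\<in>T2. edge_weight G e)"
      using fin F b by (intro mult_right_mono prod_mult_le_prod_Un prod_nonneg) (auto simp: E_def)
    moreover have "\<dots> \<le> (\<Prod>e\<in>E. edge_weight G e)"
      unfolding E_def using fin F b by (intro prod_mult_le_prod_Un) (auto simp: E_def)
    ultimately show ?thesis
      by (simp add: T1(2) T2(2))
  qed
qed

lemma max_spanning_tree_weight_join_overlap:
  assumes "weighted_graph G" "finite U" "finite V" "U \<subseteq> verts G" "V \<subseteq> verts G" "x \<in> U" "x \<in> V"
  shows "max_spanning_tree_weight (induced G U) * max_spanning_tree_weight (induced G V)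
    \<le> max_spanning_tree_weight (induced G (U \<union> V))"
  using max_spanning_tree_weight_join[OF assms(1-5), of "{}" x x] assms by simp

lemma max_spanning_tree_weight_join_edge:
  assumes "weighted_graph G" "finite U" "finite V" "U \<subseteq> verts G" "V \<subseteq> verts G"
    "x \<in> U" "y \<in> V" "x \<noteq> y" "0 < weight G x y"
  shows "max_spanning_tree_weight (induced G U) * weight G x y * max_spanning_tree_weight (induced G V)
    \<le> max_spanning_tree_weight (induced G (U \<union> V))"
proof -
  have "{{x, y}} \<subseteq> edges (induced G (U \<union> V))"
    using assms by (auto simp: edges_def)
  from max_spanning_tree_weight_join[OF assms(1-5) _ this, of x y] show ?thesis
    using assms by (auto simp: edge_weight_doubleton subset_iff)
qed

lemma max_spanning_tree_weight_singleton:
  assumes "weighted_graph G" "v \<in> verts G"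
  shows "1 \<le> max_spanning_tree_weight (induced G {v})"
proof -
  have "connected_by (verts (induced G {v})) {}"
    using assms by (auto simp: connected_by_def)
  from connected_weight_le_max_spanning_tree[OF weighted_graph_induced[OF assms(1)] _ _ this]
  show ?thesis by simp
qed

section \<open>Moments of multiset permutations\<close>

lemma integral_perm_space:
  fixes g :: "nat list \<Rightarrow> real"
  shows "(\<integral>\<sigma>. g \<sigma> \<partial>perm_space M) = (\<Sum>\<sigma>\<in>permutations_of_multiset M. g \<sigma>) / card (permutations_of_multiset M)"
  unfolding perm_space_def by (rule integral_pmf_of_set) auto

lemma length_permutations_of_multiset: "\<sigma> \<in> permutations_of_multiset M \<Longrightarrow> length \<sigma> = size M"
  by (auto simp: permutations_of_multiset_def)

text \<open>Exchanging two positions is an involution of the set of words with content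
  \<open>M\<close>.\<close>

lemma sum_permutations_swap:
  fixes M :: "nat multiset"
  assumes "a < size M" "b < size M"
  shows "(\<Sum>\<sigma>\<in>permutations_of_multiset M. g (\<sigma>[a := \<sigma> ! b, b := \<sigma> ! a])) = (\<Sum>\<sigma>\<in>permutations_of_multiset M. g \<sigma>)"
proof -
  define sw where "sw \<sigma> = \<sigma>[a := \<sigma> ! b, b := \<sigma> ! a]" for \<sigma> :: "nat list"
  have closed: "sw \<sigma> \<in> permutations_of_multiset M" if "\<sigma> \<in> permutations_of_multiset M" for \<sigma>
    using that mset_swap[of b \<sigma> a] assms length_permutations_of_multiset[OF that]
    by (simp add: permutations_of_multiset_def sw_def)
  have invol: "sw (sw \<sigma>) = \<sigma>" if "\<sigma> \<in> permutations_of_multiset M" for \<sigma>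
    using assms length_permutations_of_multiset[OF that]
    by (intro nth_equalityI) (auto simp: nth_list_update sw_def)
  have "(\<Sum>\<sigma>\<in>permutations_of_multiset M. g (sw \<sigma>)) = (\<Sum>\<sigma>\<in>permutations_of_multiset M. g \<sigma>)"
    by (rule sum.reindex_bij_witness[where i = sw and j = sw]) (simp_all add: closed invol)
  then show ?thesis
    by (simp add: sw_def)
qed

lemma sum_positions_eq_count:
  assumes "\<sigma> \<in> permutations_of_multiset M"
  shows "(\<Sum>i\<in>{1..size M}. perm_var (i, j) \<sigma>) = count M j"
proof -
  have \<sigma>: "mset \<sigma> = M" "length \<sigma> = size M"
    using assms by (auto simp: permutations_of_multiset_def)
  have "(\<Sum>i\<in>{1..size M}. perm_var (i, j) \<sigma>) = (\<Sum>i\<in>{..<length \<sigma>}. if \<sigma> ! i = j then 1 else 0)"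
    \<comment> \<open>Positions in \<open>perm_var\<close> start at 1, list indices at 0.\<close>
    by (rule sum.reindex_bij_witness[where i = Suc and j = "\<lambda>i. i - 1"]) (auto simp: \<sigma>(2))
  also have "\<dots> = card {i. i < length \<sigma> \<and> j = \<sigma> ! i}"
    by (simp add: sum.If_cases eq_commute lessThan_def Collect_conj_eq)
  also have "card {i. i < length \<sigma> \<and> j = \<sigma> ! i} = count M j"
    by (simp add: \<sigma>(1)[symmetric] count_mset count_list_eq_length_filter length_filter_conv_card)
  finally show ?thesis .
qed

lemma perm_var_cases: "perm_var a \<sigma> = (if \<sigma> ! (fst a - 1) = snd a then 1 else 0)"
  by (cases a) simp

text \<open>The labels are given by a family \<alpha> that may repeat, so that multisets of
  variables are handled by set functions on the indices.\<close>

definition perm_moment :: "nat multiset \<Rightarrow> ('i \<Rightarrow> nat \<times> nat) \<Rightarrow> 'i set \<Rightarrow> real" where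
  "perm_moment M \<alpha> T = (\<integral>\<sigma>. (\<Prod>i\<in>T. perm_var (\<alpha> i) \<sigma>) \<partial>perm_space M)"

text \<open>
  Given the letters at the positions of \<open>U\<close>, the remaining positions are exchangeable, so the mean
  of \<open>X\<^sub>x\<close> may be replaced by the mean over all remaining positions.
\<close>

lemma perm_moment_recursion:
  fixes \<alpha> :: "'i \<Rightarrow> nat \<times> nat"
  assumes U: "finite U" "x \<notin> U" and \<alpha>: "\<alpha> ` insert x U \<subseteq> perm_index M" and inj: "inj_on (fst \<circ> \<alpha>) (insert x U)"
  shows "(real (size M) - card U) * perm_moment M \<alpha> (insert x U)
    = (real (count M (snd (\<alpha> x))) - (\<Sum>u\<in>U. of_bool (snd (\<alpha> u) = snd (\<alpha> x)))) * perm_moment M \<alpha> U"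
proof -
  define n where "n = size M"
  define S where "S = permutations_of_multiset M"
  define j where "j = snd (\<alpha> x)"
  define p where "p u = fst (\<alpha> u)" for u
  define X where "X \<sigma> = (\<Prod>u\<in>U. perm_var (\<alpha> u) \<sigma>)" for \<sigma>
  have pos: "p u \<in> {1..n}" if "u \<in> insert x U" for u
    using \<alpha> that by (auto simp: perm_index_def p_def n_def)
  have injp: "inj_on p U" and pU: "p ` U \<subseteq> {1..n}" and px: "p x \<notin> p ` U"
    using inj pos U(2) by (auto simp: p_def[abs_def] o_def inj_on_def)
  \<comment> \<open>Swapping position \<open>i\<close> with the position of \<open>x\<close> leaves
    \<open>X\<close> unchanged, since neither is a position used by \<open>U\<close>.\<close>
  have exch: "(\<Sum>\<sigma>\<in>S. X \<sigma> * perm_var (i, j) \<sigma>) = (\<Sum>\<sigma>\<in>S. X \<sigma> * perm_var (\<alpha> x) \<sigma>)"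
    if i: "i \<in> {1..n} - p ` U" for i
  proof -
    let ?a = "i - 1" and ?b = "p x - 1"
    let ?sw = "\<lambda>\<sigma>. \<sigma>[?a := \<sigma> ! ?b, ?b := \<sigma> ! ?a]"
    have ab: "?a < n" "?b < n" "i \<ge> 1" "p x \<ge> 1"
      using i pos[of x] by auto
    have "(\<Sum>\<sigma>\<in>S. X \<sigma> * perm_var (\<alpha> x) \<sigma>) = (\<Sum>\<sigma>\<in>S. X (?sw \<sigma>) * perm_var (\<alpha> x) (?sw \<sigma>))"
      unfolding S_def using ab by (intro sum_permutations_swap[symmetric]) (auto simp: n_def)
    also have "\<dots> = (\<Sum>\<sigma>\<in>S. X \<sigma> * perm_var (i, j) \<sigma>)"
    proof (rule sum.cong)
      fix \<sigma> assume "\<sigma> \<in> S"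
      then have len: "length \<sigma> = n"
        by (simp add: S_def n_def length_permutations_of_multiset)
      have "perm_var (\<alpha> u) (?sw \<sigma>) = perm_var (\<alpha> u) \<sigma>" if u: "u \<in> U" for u
      proof -
        have "p u \<noteq> i" "p u \<noteq> p x" "p u \<ge> 1"
          using i px u pos[of u] imageI[OF u, of p] by (metis DiffD2, metis, simp)
        then have "p u - 1 \<noteq> ?a" "p u - 1 \<noteq> ?b"
          using ab by linarith+
        then show ?thesis
          by (simp add: perm_var_cases p_def[symmetric])
      qed
      then have "X (?sw \<sigma>) = X \<sigma>"
        by (simp add: X_def)
      moreover have "?sw \<sigma> ! ?b = \<sigma> ! ?a"
        using ab len by simp
      then have "perm_var (\<alpha> x) (?sw \<sigma>) = perm_var (i, j) \<sigma>"
        by (simp only: perm_var_cases[of "\<alpha> x"] p_def[symmetric] j_def[symmetric] perm_var.simps)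
      ultimately show "X (?sw \<sigma>) * perm_var (\<alpha> x) (?sw \<sigma>) = X \<sigma> * perm_var (i, j) \<sigma>"
        by simp
    qed simp
    finally show ?thesis ..
  qed
  \<comment> \<open>Where \<open>X\<close> is nonzero, the positions of \<open>U\<close> carry their
    prescribed letters, so the copies of \<open>j\<close> left for the other positions are
    determined. Elsewhere both sides are 0.\<close>
  have letters: "X \<sigma> * (\<Sum>i\<in>{1..n} - p ` U. perm_var (i, j) \<sigma>)
      = X \<sigma> * (real (count M j) - (\<Sum>u\<in>U. of_bool (snd (\<alpha> u) = j)))" if \<sigma>: "\<sigma> \<in> S" for \<sigma>
  proof (cases "X \<sigma> = 0")
    case False
    then have "\<sigma> ! (p u - 1) = snd (\<alpha> u)" if "u \<in> U" for u
      using that U by (auto simp: X_def perm_var_cases p_def split: if_splits)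
    then have "(\<Sum>i\<in>p ` U. perm_var (i, j) \<sigma>) = (\<Sum>u\<in>U. of_bool (snd (\<alpha> u) = j))"
      by (auto simp: sum.reindex[OF injp] intro!: sum.cong)
    moreover have "(\<Sum>i\<in>{1..n}. perm_var (i, j) \<sigma>) = count M j"
      using sum_positions_eq_count \<sigma> by (simp add: n_def S_def)
    ultimately show ?thesis
      using pU by (simp add: sum_diff)
  qed simp
  have "card ({1..n} - p ` U) = n - card U"
    using pU injp U by (simp add: card_Diff_subset card_image)
  moreover have "card U \<le> n"
    using card_mono[OF _ pU] injp by (simp add: card_image)
  \<comment> \<open>By \<open>exch\<close> all the free positions contribute the same sum.\<close>
  ultimately have "(n - real (card U)) * (\<Sum>\<sigma>\<in>S. X \<sigma> * perm_var (\<alpha> x) \<sigma>)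
      = (\<Sum>i\<in>{1..n} - p ` U. \<Sum>\<sigma>\<in>S. X \<sigma> * perm_var (i, j) \<sigma>)"
    using exch by (simp add: of_nat_diff)
  also have "\<dots> = (\<Sum>\<sigma>\<in>S. X \<sigma> * (\<Sum>i\<in>{1..n} - p ` U. perm_var (i, j) \<sigma>))"
    by (subst sum.swap) (simp add: sum_distrib_left)
  also have "\<dots> = (real (count M j) - (\<Sum>u\<in>U. of_bool (snd (\<alpha> u) = j))) * (\<Sum>\<sigma>\<in>S. X \<sigma>)"
    by (subst mult.commute) (simp only: sum_distrib_right letters cong: sum.cong)
  finally have "(n - real (card U)) * (\<Sum>\<sigma>\<in>S. X \<sigma> * perm_var (\<alpha> x) \<sigma>)
      = (real (count M j) - (\<Sum>u\<in>U. of_bool (snd (\<alpha> u) = j))) * (\<Sum>\<sigma>\<in>S. X \<sigma>)" .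
  moreover have "perm_moment M \<alpha> (insert x U) = (\<Sum>\<sigma>\<in>S. X \<sigma> * perm_var (\<alpha> x) \<sigma>) / card S"
    using U by (simp add: perm_moment_def integral_perm_space S_def X_def mult.commute)
  moreover have "perm_moment M \<alpha> U = (\<Sum>\<sigma>\<in>S. X \<sigma>) / card S"
    by (simp add: perm_moment_def integral_perm_space S_def X_def)
  ultimately show ?thesis
    by (simp add: n_def j_def)
qed

lemma prob_space_perm_space: "prob_space (perm_space M)"
  unfolding perm_space_def by (rule prob_space_measure_pmf)

lemma perm_moment_empty: "perm_moment M \<alpha> {} = 1"
  using prob_space.prob_space[OF prob_space_perm_space] by (simp add: perm_moment_def)

text \<open>A position carries only one letter, so the product of two indicators at the same
  position is either indicator if the labels agree and 0 otherwise.\<close>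

lemma perm_moment_merge:
  assumes "finite U" "x \<notin> U" "y \<notin> U" "x \<noteq> y" "fst (\<alpha> x) = fst (\<alpha> y)"
  shows "perm_moment M \<alpha> (insert x (insert y U)) = of_bool (\<alpha> x = \<alpha> y) * perm_moment M \<alpha> (insert x U)"
proof -
  have "perm_var (\<alpha> x) \<sigma> * perm_var (\<alpha> y) \<sigma> = of_bool (\<alpha> x = \<alpha> y) * perm_var (\<alpha> x) \<sigma>" for \<sigma>
    using assms(5) by (auto simp: perm_var_cases prod_eq_iff)
  then have "(\<Prod>i\<in>insert x (insert y U). perm_var (\<alpha> i) \<sigma>)
      = of_bool (\<alpha> x = \<alpha> y) * (\<Prod>i\<in>insert x U. perm_var (\<alpha> i) \<sigma>)" for \<sigma>
    using assms by (simp flip: mult.assoc)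
  then show ?thesis
    by (simp add: perm_moment_def)
qed

section \<open>Integrability of the variables and admissibility of the graph\<close>

lemma integrable_perm_space: "integrable (perm_space M) (g :: nat list \<Rightarrow> real)"
  unfolding perm_space_def by (rule integrable_measure_pmf_finite) simp

lemma measurable_perm_space: "(g :: nat list \<Rightarrow> real) \<in> borel_measurable (perm_space M)"
  unfolding perm_space_def by simp

text \<open>Every letter occurring in \<open>M\<close> has multiplicity between 1 and
  \<open>size M\<close>. The uniform lower bound makes any two distinct labels adjacent at a cost of
  at most a factor \<open>size M\<close>.\<close>

lemma perm_weight_bounds:
  assumes "u \<in> perm_index M" "v \<in> perm_index M" "u \<noteq> v"
  shows "1 / size M \<le> perm_weight M u v" "0 < perm_weight M u v" "perm_weight M u v \<le> 1"
proof -
  obtain i j i' j' where uv: "u = (i, j)" "v = (i', j')"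
    by (cases u, cases v)
  have c: "1 \<le> real (count M j)" "real (count M j) \<le> real (size M)"
    using assms(1) by (auto simp: uv perm_index_def Suc_le_eq count_le_size)
  then have n: "1 \<le> real (size M)" "0 < real (size M)" "0 < real (count M j)"
    by linarith+
  have "1 / real (size M) \<le> 1" "1 / real (size M) \<le> 1 / real (count M j)" "1 / real (count M j) \<le> 1"
    "0 < 1 / real (size M)" "0 < 1 / real (count M j)"
    using c n by (simp_all add: frac_le divide_le_eq_1_pos del: of_nat_0_less_iff)
  then show "1 / size M \<le> perm_weight M u v" "0 < perm_weight M u v" "perm_weight M u v \<le> 1"
    using assms(3) by (auto simp: uv simp del: divide_le_eq_1 divide_less_cancel zero_less_divide_iff)
qed

lemma weighted_graph_perm_graph: "weighted_graph (perm_graph M)"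
proof -
  have "perm_weight M u u = 0" for u
    by (cases u) simp
  moreover have "perm_weight M u v = perm_weight M v u" for u v
    by (cases u; cases v) auto
  moreover have "0 \<le> perm_weight M u v \<and> perm_weight M u v \<le> 1"
    if "u \<in> perm_index M" "v \<in> perm_index M" for u v
  proof (cases "u = v")
    case True
    then show ?thesis by (cases v) simp
  next
    case False
    then show ?thesis
      using perm_weight_bounds[OF that] by auto
  qed
  ultimately show ?thesis
    by (simp add: weighted_graph_def perm_graph_def)
qed

section \<open>Cumulants of multiset permutations\<close>

definition letter_freq :: "nat multiset \<Rightarrow> nat \<times> nat \<Rightarrow> real" where
  "letter_freq M v = real (count M (snd v)) / real (size M)"

text \<open>The right-hand side of the required estimate without its constant, as a function of the
  set of distinct labels.\<close>

definition dep_bound :: "nat multiset \<Rightarrow> (nat \<times> nat) set \<Rightarrow> real" where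
  "dep_bound M S = (\<Prod>v\<in>S. letter_freq M v) * max_spanning_tree_weight (induced (perm_graph M) S)"

lemma perm_Psi_eq: "perm_Psi M B = (\<Prod>v\<in>set_mset B. letter_freq M v)"
  unfolding perm_Psi_def letter_freq_def by (rule prod.cong) auto

lemma letter_freq_bounds: "0 \<le> letter_freq M v" "letter_freq M v \<le> 1"
  by (simp_all add: letter_freq_def divide_le_eq_1_pos count_le_size divide_le_eq)

lemma verts_perm_graph [simp]: "verts (perm_graph M) = perm_index M"
  and weight_perm_graph [simp]: "weight (perm_graph M) = perm_weight M"
  by (simp_all add: perm_graph_def)

lemma finite_perm_index: "finite (perm_index M)"
  by (simp add: perm_index_def)

lemma mst_perm_graph_nonneg: "0 \<le> max_spanning_tree_weight (induced (perm_graph M) S)"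
  by (rule max_spanning_tree_weight_nonneg)
     (auto intro: weighted_graph_induced weighted_graph_perm_graph simp: finite_perm_index)

lemma dep_bound_nonneg: "0 \<le> dep_bound M S"
  unfolding dep_bound_def by (intro mult_nonneg_nonneg prod_nonneg mst_perm_graph_nonneg) (simp add: letter_freq_bounds)

text \<open>Carries a joining estimate for trees over to \<open>dep_bound\<close>: frequencies are
  at most 1, so those of labels common to \<open>U\<close> and \<open>V\<close> may be counted once
  instead of twice.\<close>

lemma dep_bound_joinI:
  assumes "finite U" "finite V" "0 \<le> w"
    and "max_spanning_tree_weight (induced (perm_graph M) U) * w * max_spanning_tree_weight (induced (perm_graph M) V)
      \<le> max_spanning_tree_weight (induced (perm_graph M) (U \<union> V))"
  shows "dep_bound M U * w * dep_bound M V \<le> dep_bound M (U \<union> V)"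
proof -
  have "(\<Prod>v\<in>U. letter_freq M v) * (\<Prod>v\<in>V. letter_freq M v) \<le> (\<Prod>v\<in>U \<union> V. letter_freq M v)"
    using assms by (intro prod_mult_le_prod_Un) (simp_all add: letter_freq_bounds)
  then have "((\<Prod>v\<in>U. letter_freq M v) * (\<Prod>v\<in>V. letter_freq M v)) *
      (max_spanning_tree_weight (induced (perm_graph M) U) * w * max_spanning_tree_weight (induced (perm_graph M) V))
    \<le> (\<Prod>v\<in>U \<union> V. letter_freq M v) * max_spanning_tree_weight (induced (perm_graph M) (U \<union> V))"
    using assms by (intro mult_mono mult_nonneg_nonneg prod_nonneg mst_perm_graph_nonneg) (simp_all add: letter_freq_bounds)
  then show ?thesis
    by (simp add: dep_bound_def algebra_simps)
qed

lemma dep_bound_join_overlap: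
  assumes "U \<subseteq> perm_index M" "V \<subseteq> perm_index M" "x \<in> U" "x \<in> V"
  shows "dep_bound M U * dep_bound M V \<le> dep_bound M (U \<union> V)"
proof -
  have fin: "finite U" "finite V"
    using assms by (auto intro: finite_subset[OF _ finite_perm_index])
  show ?thesis
    using dep_bound_joinI[OF fin, of 1 M] max_spanning_tree_weight_join_overlap[OF weighted_graph_perm_graph fin, of M x] assms
    by simp
qed

lemma dep_bound_join_edge:
  assumes "U \<subseteq> perm_index M" "V \<subseteq> perm_index M" "x \<in> U" "y \<in> V" "x \<noteq> y"
  shows "dep_bound M U * perm_weight M x y * dep_bound M V \<le> dep_bound M (U \<union> V)"
proof -
  have fin: "finite U" "finite V"
    using assms by (auto intro: finite_subset[OF _ finite_perm_index])
  have "0 < perm_weight M x y"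
    using assms by (intro perm_weight_bounds) auto
  then show ?thesis
    using max_spanning_tree_weight_join_edge[OF weighted_graph_perm_graph fin, of M x y] assms
    by (intro dep_bound_joinI fin) auto
qed

text \<open>Uses only the smallest possible weight \<open>1 / size M\<close> of the linking edge.
  The lost factor \<open>size M\<close> is regained from the division in the sampling
  recursion.\<close>

lemma dep_bound_join:
  assumes "U \<subseteq> perm_index M" "V \<subseteq> perm_index M" "x \<in> U" "y \<in> V" "x \<noteq> y"
  shows "dep_bound M U * dep_bound M V \<le> size M * dep_bound M (U \<union> V)"
proof -
  have n: "0 < size M"
    using assms by (auto simp: perm_index_def)
  have "dep_bound M U * (1 / size M) * dep_bound M V \<le> dep_bound M U * perm_weight M x y * dep_bound M V"
    using assms perm_weight_bounds(1)[of x M y] by (intro mult_right_mono mult_left_mono dep_bound_nonneg) auto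
  also have "\<dots> \<le> dep_bound M (U \<union> V)"
    by (rule dep_bound_join_edge[OF assms])
  finally show ?thesis
    using n by (simp add: field_simps)
qed

lemma dep_bound_singleton:
  assumes "x \<in> perm_index M"
  shows "letter_freq M x \<le> dep_bound M {x}"
  using mult_left_mono[OF max_spanning_tree_weight_singleton[OF weighted_graph_perm_graph, of x M]
      letter_freq_bounds(1)[of M x]] assms
  by (simp add: dep_bound_def)

text \<open>With \<open>a\<close> the multiplicity of the common letter, attaching \<open>x\<close>
  contributes the frequency \<open>a / size M\<close> and an edge of weight \<open>1 / a\<close>;
  their product is exactly \<open>1 / size M\<close>.\<close>

lemma dep_bound_insert_same_letter:
  assumes "V \<subseteq> perm_index M" "x \<in> perm_index M" "y \<in> V" "snd x = snd y" "fst x \<noteq> fst y"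
  shows "dep_bound M V \<le> size M * dep_bound M (insert x V)"
proof -
  have c: "0 < count M (snd x)"
    using assms(2) by (auto simp: perm_index_def)
  have n: "0 < size M"
    using assms(2) by (auto simp: perm_index_def)
  have w: "perm_weight M x y = 1 / count M (snd x)"
    using assms(4,5) by (cases x; cases y) auto
  have "dep_bound M V * (1 / size M) = letter_freq M x * perm_weight M x y * dep_bound M V"
    using c by (simp add: w letter_freq_def)
  also have "\<dots> \<le> dep_bound M {x} * perm_weight M x y * dep_bound M V"
    using assms by (intro mult_right_mono dep_bound_singleton dep_bound_nonneg) (auto simp: w)
  also have "\<dots> \<le> dep_bound M ({x} \<union> V)"
    using assms by (intro dep_bound_join_edge) auto
  finally show ?thesis
    using n by (simp add: field_simps)
qed

section \<open>The constants and the inductive bound\<close>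

text \<open>The power of 2 accounts for the sum over subsets, the square of the previous constant
  for products of two smaller cumulants. One factor \<open>Suc m\<close> bounds the cardinalities in
  the sampling recursion, the other comes from \<open>n \<le> Suc m * (n - m)\<close>.\<close>

primrec dep_const :: "nat \<Rightarrow> real" where
  "dep_const 0 = 1"
| "dep_const (Suc m) = 2 ^ Suc m * (real (Suc m))\<^sup>2 * (dep_const m)\<^sup>2"

lemma dep_const_ge_1: "1 \<le> dep_const m"
proof (induction m)
  case (Suc m)
  have "1 * 1 * 1 \<le> (2::real) ^ Suc m * (real (Suc m))\<^sup>2 * (dep_const m)\<^sup>2"
    by (intro mult_mono one_le_power Suc) auto
  then show ?case by simp
qed simp

text \<open>Allows one constant to serve for all proper subsets in the induction.\<close>

lemma dep_const_mono: "m \<le> m' \<Longrightarrow> dep_const m \<le> dep_const m'"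
proof (rule lift_Suc_mono_le[of dep_const])
  fix k
  have "1 * 1 * 1 \<le> 2 ^ Suc k * (real (Suc k))\<^sup>2 * dep_const k"
    by (intro mult_mono one_le_power dep_const_ge_1) auto
  then have "1 * dep_const k \<le> (2 ^ Suc k * (real (Suc k))\<^sup>2 * dep_const k) * dep_const k"
    using dep_const_ge_1[of k] by (intro mult_right_mono) auto
  then show "dep_const k \<le> dep_const (Suc k)"
    by (simp add: power2_eq_square mult.assoc)
qed

text \<open>The induction counts indices, while the bound sees only the set of their labels. Indices
  with equal labels share their position and so fall into the merging case.\<close>

lemma perm_cumulant_bound:
  "finite S \<Longrightarrow> S \<noteq> {} \<Longrightarrow> \<alpha> ` S \<subseteq> perm_index M \<Longrightarrow>
    \<bar>cumulant (perm_moment M \<alpha>) S\<bar> \<le> dep_const (card S) * dep_bound M (\<alpha> ` S)"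
proof (induction "card S" arbitrary: S rule: less_induct)
  case less
  let ?K = "cumulant (perm_moment M \<alpha>)" and ?b = "\<lambda>A. dep_bound M (\<alpha> ` A)"
  define n where "n = size M"
  define m where "m = card S - 1"
  define D where "D = dep_const m"
  define b where "b = ?b S"
  note idx = less.prems(3)
  note f1 = perm_moment_empty[of M \<alpha>]
  have fin: "finite A" if "A \<subseteq> S" for A
    using that less.prems(1) finite_subset by auto
  have b0: "0 \<le> b" and D1: "1 \<le> D"
    by (simp_all add: b_def D_def dep_bound_nonneg dep_const_ge_1)
  have DD: "D \<le> D\<^sup>2"
    using D1 by (simp add: power2_eq_square)
  have m: "card S = Suc m"
    using less.prems by (simp add: m_def card_gt_0_iff)
  have IH: "\<bar>?K A\<bar> \<le> D * ?b A" if A: "A \<subset> S" "A \<noteq> {}" for A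
  proof -
    have "card A < card S"
      using A less.prems by (intro psubset_card_mono)
    then have "\<bar>?K A\<bar> \<le> dep_const (card A) * ?b A" "dep_const (card A) \<le> D"
      using less.hyps[of A] A idx fin[of A] m by (auto simp: D_def intro: dep_const_mono)
    then show ?thesis
      using mult_right_mono[OF _ dep_bound_nonneg[of M "\<alpha> ` A"]] by (meson order_trans)
  qed
  have IH2: "\<bar>?K A * ?K A'\<bar> \<le> D\<^sup>2 * (?b A * ?b A')" if "A \<subset> S" "A \<noteq> {}" "A' \<subset> S" "A' \<noteq> {}" for A A'
  proof -
    have "\<bar>?K A\<bar> * \<bar>?K A'\<bar> \<le> (D * ?b A) * (D * ?b A')"
      using D1 that by (intro mult_mono IH mult_nonneg_nonneg dep_bound_nonneg) auto
    then show ?thesis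
      by (simp add: abs_mult power2_eq_square algebra_simps)
  qed
  show ?case
  proof (cases "inj_on (fst \<circ> \<alpha>) S")
    case False
    then obtain x y where xy: "x \<in> S" "y \<in> S" "x \<noteq> y" "fst (\<alpha> x) = fst (\<alpha> y)"
      by (auto simp: inj_on_def)
    define R where "R = S - {x, y}"
    have S: "S = insert x (insert y R)" "x \<notin> R" "y \<notin> R" "R \<subseteq> S" "finite R"
      using xy fin[of R] by (auto simp: R_def)
    have cardR: "card R \<le> m"
      using m S xy by simp
    define c :: real where "c = of_bool (\<alpha> x = \<alpha> y)"
    have join: "?b (insert x A) * ?b (insert y (R - A)) \<le> b" if A: "A \<subseteq> R" for A
    proof -
      have un: "\<alpha> ` insert x A \<union> \<alpha> ` insert y (R - A) = \<alpha> ` S"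
        using A unfolding S(1) by auto
      have sub: "\<alpha> ` insert x A \<subseteq> perm_index M" "\<alpha> ` insert y (R - A) \<subseteq> perm_index M"
        using idx un by (metis Un_upper1 Un_upper2 order_trans)+
      show ?thesis
      proof (cases "\<alpha> x = \<alpha> y")
        case True
        then show ?thesis
          using dep_bound_join_overlap[OF sub, of "\<alpha> x"] unfolding un b_def by simp
      next
        case False
        then have "perm_weight M (\<alpha> x) (\<alpha> y) = 1"
          using xy(4) by (cases "\<alpha> x"; cases "\<alpha> y") auto
        then show ?thesis
          using dep_bound_join_edge[OF sub, of "\<alpha> x" "\<alpha> y"] False unfolding un b_def by simp
      qed
    qed
    have conv: "\<bar>subset_conv (\<lambda>A. ?K (insert x A)) (\<lambda>A. ?K (insert y A)) R\<bar> \<le> 2 ^ card R * (D\<^sup>2 * b)"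
    proof (rule abs_subset_conv_le[OF S(5)])
      fix A assume A: "A \<subseteq> R"
      have "\<bar>?K (insert x A) * ?K (insert y (R - A))\<bar> \<le> D\<^sup>2 * (?b (insert x A) * ?b (insert y (R - A)))"
      proof (rule IH2)
        show "insert x A \<subset> S" "insert y (R - A) \<subset> S"
          using A xy(1-3) unfolding R_def by blast+
      qed simp_all
      also have "\<dots> \<le> D\<^sup>2 * b"
        by (rule mult_left_mono[OF join[OF A]]) simp
      finally show "\<bar>?K (insert x A) * ?K (insert y (R - A))\<bar> \<le> D\<^sup>2 * b" .
    qed
    \<comment> \<open>The term survives only if the labels of \<open>x\<close> and \<open>y\<close>
      coincide; dropping \<open>y\<close> then leaves the set of labels, and hence \<open>b\<close>,
      unchanged.\<close>
    have cK: "\<bar>c * ?K (insert x R)\<bar> \<le> D\<^sup>2 * b"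
    proof (cases "\<alpha> x = \<alpha> y")
      case True
      then have "\<alpha> ` insert x R = \<alpha> ` S"
        unfolding S(1) by auto
      moreover have xR: "insert x R \<subset> S" "insert x R \<noteq> {}"
        using xy(1-3) by (auto simp: R_def psubset_eq set_eq_iff)
      ultimately have "\<bar>?K (insert x R)\<bar> \<le> D * b"
        using IH[OF xR] by (simp add: b_def)
      also have "\<dots> \<le> D\<^sup>2 * b"
        by (rule mult_right_mono[OF DD b0])
      finally show ?thesis
        by (simp add: c_def True)
    next
      case False
      then show ?thesis
        using b0 by (simp add: c_def)
    qed
    have "?K S = c * ?K (insert x R) - subset_conv (\<lambda>A. ?K (insert x A)) (\<lambda>A. ?K (insert y A)) R"
      unfolding S(1) c_def
      by (rule cumulant_merge[where f = "perm_moment M \<alpha>", OF S(5,2,3) xy(3) f1])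
         (rule perm_moment_merge; use S(2-5) xy(3,4) finite_subset in blast)
    then have "\<bar>?K S\<bar> \<le> D\<^sup>2 * b + 2 ^ card R * (D\<^sup>2 * b)"
      using cK conv by linarith
    also have "\<dots> \<le> 2 ^ Suc m * (D\<^sup>2 * b)"
    proof -
      have "(1::real) + 2 ^ card R \<le> 2 ^ m + 2 ^ m"
        using cardR by (intro add_mono one_le_power power_increasing) auto
      then have "(1 + 2 ^ card R) * (D\<^sup>2 * b) \<le> 2 ^ Suc m * (D\<^sup>2 * b)"
        using b0 by (intro mult_right_mono) auto
      then show ?thesis
        by (simp add: algebra_simps)
    qed
    also have "\<dots> \<le> 2 ^ Suc m * (real (Suc m))\<^sup>2 * D\<^sup>2 * b"
    proof -
      have "1 * (2 ^ Suc m * (D\<^sup>2 * b)) \<le> (real (Suc m))\<^sup>2 * (2 ^ Suc m * (D\<^sup>2 * b))"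
        using b0 by (intro mult_right_mono one_le_power) auto
      then show ?thesis
        by (simp add: algebra_simps)
    qed
    finally show ?thesis
      by (simp add: m D_def b_def)
  next
    case inj: True
    obtain x where x: "x \<in> S"
      using less.prems(2) by auto
    define R where "R = S - {x}"
    have S: "S = insert x R" "x \<notin> R" "R \<subseteq> S" "finite R"
      using x fin[of R] by (auto simp: R_def)
    have cardR: "card R = m"
      using m S by simp
    have rec: "(real n - card U) * perm_moment M \<alpha> (insert x U)
        = (real (count M (snd (\<alpha> x))) - (\<Sum>u\<in>U. of_bool (snd (\<alpha> u) = snd (\<alpha> x)))) * perm_moment M \<alpha> U"
      if "U \<subseteq> R" for U
    proof -
      have sub: "insert x U \<subseteq> S"
        using that S(1) by blast
      show ?thesis
        unfolding n_def
      proof (rule perm_moment_recursion)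
        show "finite U" "x \<notin> U"
          using that S(2) fin[of U] sub by auto
        show "\<alpha> ` insert x U \<subseteq> perm_index M"
          using image_mono[OF sub] idx by (rule order_trans)
        show "inj_on (fst \<circ> \<alpha>) (insert x U)"
          using inj sub by (rule inj_on_subset)
      qed
    qed
    have n_pos: "0 < n"
      using idx x by (auto simp: n_def perm_index_def)
    show ?thesis
    \<comment> \<open>The sampling recursion assumes a nonempty \<open>R\<close>. For a single
      variable the cumulant is its mean, the letter frequency.\<close>
    proof (cases "R = {}")
      case True
      have "?K S = perm_moment M \<alpha> {x}"
        using f1 by (simp add: S(1) True cumulant_singleton)
      also have "\<dots> = letter_freq M (\<alpha> x)"
      proof -
        have "real n * perm_moment M \<alpha> {x} = count M (snd (\<alpha> x))"
          using rec[of "{}"] f1 by simp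
        then have "perm_moment M \<alpha> {x} = count M (snd (\<alpha> x)) / real n"
          using n_pos by (simp add: nonzero_eq_divide_eq mult.commute)
        then show ?thesis
          by (simp add: letter_freq_def n_def)
      qed
      finally have "\<bar>?K S\<bar> \<le> 1 * b"
        using dep_bound_singleton[of "\<alpha> x" M] idx x by (simp add: b_def S(1) True letter_freq_bounds)
      also have "\<dots> \<le> dep_const (card S) * b"
        by (intro mult_right_mono b0 dep_const_ge_1)
      finally show ?thesis
        by (simp add: b_def)
    next
      case False
      have recK: "(real n - m) * ?K S = subset_conv (\<lambda>A. ?K (insert x A)) (\<lambda>A. card A * ?K A) R
          - (\<Sum>u\<in>R. of_bool (snd (\<alpha> u) = snd (\<alpha> x))) * ?K R"
        unfolding S(1) cardR[symmetric] by (rule cumulant_sampling_recursion[where f = "perm_moment M \<alpha>", OF S(4,2) False f1 rec])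
      have conv: "\<bar>subset_conv (\<lambda>A. ?K (insert x A)) (\<lambda>A. card A * ?K A) R\<bar> \<le> 2 ^ card R * (m * (D\<^sup>2 * (n * b)))"
      proof (rule abs_subset_conv_le[OF S(4)])
        fix A assume A: "A \<subseteq> R"
        show "\<bar>?K (insert x A) * (card (R - A) * ?K (R - A))\<bar> \<le> m * (D\<^sup>2 * (n * b))"
        \<comment> \<open>For \<open>A = R\<close> the first factor is the cumulant of
          \<open>S\<close> itself, which the induction hypothesis does not bound; the coefficient
          \<open>card (R - A) = 0\<close> removes this term.\<close>
        proof (cases "R - A = {}")
          case True
          show ?thesis
            unfolding True using b0 by simp
        next
          case ne: False
          then obtain y where y: "y \<in> R - A" by auto
          have un: "\<alpha> ` insert x A \<union> \<alpha> ` (R - A) = \<alpha> ` S"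
            using A unfolding S(1) by auto
          have "\<alpha> x \<noteq> \<alpha> y"
            using inj x y S by (auto simp: inj_on_def)
          moreover have "\<alpha> ` insert x A \<subseteq> perm_index M" "\<alpha> ` (R - A) \<subseteq> perm_index M"
            using idx un by (metis Un_upper1 Un_upper2 order_trans)+
          ultimately have "?b (insert x A) * ?b (R - A) \<le> n * b"
            using dep_bound_join[of "\<alpha> ` insert x A" M "\<alpha> ` (R - A)" "\<alpha> x" "\<alpha> y"] y
            unfolding n_def b_def un by auto
          moreover have "\<bar>?K (insert x A) * ?K (R - A)\<bar> \<le> D\<^sup>2 * (?b (insert x A) * ?b (R - A))"
          proof (rule IH2)
            show "insert x A \<subset> S" "R - A \<subset> S"
              using A x y unfolding R_def by blast+
          qed (use ne in simp_all)
          ultimately have "\<bar>?K (insert x A) * ?K (R - A)\<bar> \<le> D\<^sup>2 * (n * b)"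
            by (meson mult_left_mono order_trans zero_le_power2)
          moreover have "card (R - A) \<le> m"
            unfolding cardR[symmetric] by (intro card_mono S(4)) auto
          ultimately have "card (R - A) * \<bar>?K (insert x A) * ?K (R - A)\<bar> \<le> m * (D\<^sup>2 * (n * b))"
            by (intro mult_mono) auto
          then show ?thesis
            by (simp add: abs_mult algebra_simps)
        qed
      qed
      have lin: "\<bar>(\<Sum>u\<in>R. of_bool (snd (\<alpha> u) = snd (\<alpha> x))) * ?K R\<bar> \<le> m * (D\<^sup>2 * (n * b))"
      \<comment> \<open>Without such a \<open>y\<close> the coefficient is 0. With it,
        \<open>x\<close> is attached to the tree of \<open>R\<close> by an edge of weight
        \<open>1 / a\<close>, where \<open>a\<close> is the multiplicity of the common
        letter.\<close>
      proof (cases "\<exists>y\<in>R. snd (\<alpha> y) = snd (\<alpha> x)")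
        case True
        then obtain y where y: "y \<in> R" "snd (\<alpha> y) = snd (\<alpha> x)" by auto
        have "fst (\<alpha> x) \<noteq> fst (\<alpha> y)"
          using inj x y S by (auto simp: inj_on_def)
        moreover have "\<alpha> ` R \<subseteq> perm_index M" "\<alpha> x \<in> perm_index M"
          using idx x S(3) by auto
        moreover have "insert (\<alpha> x) (\<alpha> ` R) = \<alpha> ` S"
          unfolding S(1) by auto
        ultimately have bR: "?b R \<le> n * b"
          using dep_bound_insert_same_letter[of "\<alpha> ` R" M "\<alpha> x" "\<alpha> y"] y
          unfolding n_def b_def by auto
        have "\<bar>?K R\<bar> \<le> D * ?b R"
          using x False unfolding R_def by (intro IH) auto
        also have "\<dots> \<le> D\<^sup>2 * (n * b)"
          using DD bR D1 by (intro mult_mono dep_bound_nonneg) auto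
        finally have "\<bar>?K R\<bar> \<le> D\<^sup>2 * (n * b)" .
        moreover have "(\<Sum>u\<in>R. of_bool (snd (\<alpha> u) = snd (\<alpha> x))) \<le> (\<Sum>u\<in>R. 1 :: real)"
          by (rule sum_mono) auto
        ultimately show ?thesis
          unfolding abs_mult cardR[symmetric] by (intro mult_mono) (auto simp: abs_of_nonneg sum_nonneg)
      next
        case none: False
        then have "(\<Sum>u\<in>R. of_bool (snd (\<alpha> u) = snd (\<alpha> x))) = (0::real)"
          by (intro sum.neutral) auto
        then show ?thesis
          using b0 by simp
      qed
      \<comment> \<open>The \<open>Suc m\<close> positions in play are distinct, so division by
        \<open>n - m\<close> is legitimate.\<close>
      have "Suc m \<le> n"
      proof -
        have "(fst \<circ> \<alpha>) ` S \<subseteq> {1..n}"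
          using idx by (auto simp: perm_index_def n_def)
        then have "card ((fst \<circ> \<alpha>) ` S) \<le> n"
          using card_mono[of "{1..n}"] by simp
        then show ?thesis
          using card_image[OF inj] m by simp
      qed
      then have nm: "n \<le> real (Suc m) * (real n - m)" "0 < real n - m"
      proof -
        \<comment> \<open>This product is exactly the difference between
          \<open>(m + 1) * (n - m)\<close> and \<open>n\<close>.\<close>
        have "0 \<le> real m * (real n - m - 1)"
          using \<open>Suc m \<le> n\<close> by (intro mult_nonneg_nonneg) auto
        then show "n \<le> real (Suc m) * (real n - m)" "0 < real n - m"
          using \<open>Suc m \<le> n\<close> by (auto simp: algebra_simps)
      qed
      have "(real n - m) * \<bar>?K S\<bar> = \<bar>(real n - m) * ?K S\<bar>"
        using nm by (simp add: abs_mult)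
      also have "\<dots> \<le> 2 ^ card R * (m * (D\<^sup>2 * (n * b))) + m * (D\<^sup>2 * (n * b))"
        using conv lin unfolding recK by linarith
      also have "\<dots> = (2 ^ m + 1) * (m * (D\<^sup>2 * b)) * n"
        by (simp add: cardR algebra_simps)
      also have "\<dots> \<le> 2 ^ Suc m * (Suc m * (D\<^sup>2 * b)) * (real (Suc m) * (real n - m))"
      proof -
        have "(2::real) ^ m + 1 \<le> 2 ^ Suc m"
          using one_le_power[of "2::real" m] by simp
        then show ?thesis
          using b0 nm by (intro mult_mono mult_nonneg_nonneg) auto
      qed
      also have "\<dots> = (real n - m) * (2 ^ Suc m * (real (Suc m))\<^sup>2 * D\<^sup>2 * b)"
        by (simp add: power2_eq_square algebra_simps)
      finally have "\<bar>?K S\<bar> \<le> 2 ^ Suc m * (real (Suc m))\<^sup>2 * D\<^sup>2 * b"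
        using nm by (simp add: mult_le_cancel_left_pos)
      then show ?thesis
        by (simp add: m D_def b_def)
    qed
  qed
qed

text \<open>A list of labels is read as a family indexed by its positions, to which
  \<open>perm_cumulant_bound\<close> applies. The constants \<open>dep_const\<close> depend only on
  the length of the list, so they serve all \<open>M\<close> at once.\<close>

theorem theorem3p1:
  shows "\<exists>C :: nat \<Rightarrow> real. (\<forall>r\<ge>1. C r > 0) \<and>
    (\<forall>M :: nat multiset. (\<forall>j\<in>#M. j \<ge> 1) \<longrightarrow>
      weighted_dependency_graph (perm_Psi M) C (perm_space M) (perm_index M) perm_var (perm_graph M))"
proof (intro exI[of _ dep_const] conjI allI impI)
  show pos: "dep_const r > 0" for r
    using dep_const_ge_1[of r] by linarith
  fix M :: "nat multiset"
  have "\<bar>joint_cumulant (perm_space M) (map perm_var \<alpha>s)\<bar> \<le> dep_const (length \<alpha>s) * perm_Psi M (mset \<alpha>s) *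
      max_spanning_tree_weight (induced (perm_graph M) (set \<alpha>s))"
    if \<alpha>s: "\<alpha>s \<noteq> []" "set \<alpha>s \<subseteq> perm_index M" for \<alpha>s
  proof -
    \<comment> \<open>The shift matches \<open>joint_cumulant\<close>, whose variables are numbered
      from 1.\<close>
    define \<alpha> where "\<alpha> i = \<alpha>s ! (i - 1)" for i
    let ?S = "{1..length \<alpha>s}"
    have img: "\<alpha> ` ?S = set \<alpha>s"
    proof -
      have "?S = Suc ` {..<length \<alpha>s}"
        by (simp add: image_Suc_lessThan)
      then show ?thesis
        by (auto simp: \<alpha>_def set_conv_nth image_image)
    qed
    have "joint_cumulant (perm_space M) (map perm_var \<alpha>s) = cumulant
        (\<lambda>B. \<integral>\<omega>. (\<Prod>i\<in>B. (map perm_var \<alpha>s ! (i - 1)) \<omega>) \<partial>perm_space M) ?S"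
      using joint_cumulant_eq_cumulant[OF prob_space_perm_space, of "map perm_var \<alpha>s" M] \<alpha>s by simp
    also have "\<dots> = cumulant (perm_moment M \<alpha>) ?S"
    proof (rule cumulant_cong)
      fix B assume "B \<subseteq> ?S"
      then have "map perm_var \<alpha>s ! (i - 1) = perm_var (\<alpha> i)" if "i \<in> B" for i
        using that by (auto simp: \<alpha>_def subset_iff)
      then show "(\<integral>\<omega>. (\<Prod>i\<in>B. (map perm_var \<alpha>s ! (i - 1)) \<omega>) \<partial>perm_space M) = perm_moment M \<alpha> B"
        unfolding perm_moment_def by (intro Bochner_Integration.integral_cong prod.cong) auto
    qed
    finally have K: "joint_cumulant (perm_space M) (map perm_var \<alpha>s) = cumulant (perm_moment M \<alpha>) ?S" .
    have "?S \<noteq> {}"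
      using \<alpha>s by (simp add: Suc_le_eq)
    then have "\<bar>cumulant (perm_moment M \<alpha>) ?S\<bar> \<le> dep_const (card ?S) * dep_bound M (set \<alpha>s)"
      using perm_cumulant_bound[of ?S \<alpha> M] \<alpha>s(2) unfolding img by blast
    then show ?thesis
      unfolding K by (simp add: dep_bound_def perm_Psi_eq mult.assoc)
  qed
  then show "weighted_dependency_graph (perm_Psi M) dep_const (perm_space M) (perm_index M) perm_var (perm_graph M)"
    unfolding weighted_dependency_graph_def
    by (auto simp: prob_space_perm_space measurable_perm_space integrable_perm_space weighted_graph_perm_graph pos)
qed

end
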